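(* Let $m\geq 1$ and $k\geq 1$ be integers with $m\geq 2k-1$. Let $\mathcal{P}$ be the space of complex-valued polynomials on $(\mathbb{R}^m)^k$, and let $\mathcal{H}\subset\mathcal{P}$ be the space of spherical harmonics, i.e. the polynomials annihilated by all mixed Laplacians $\Delta_{ij}$, $1\leq i\leq j\leq k$. Then $$\mathcal{P}=\bigoplus_{n} r^{2n}\,\mathcal{H},\qquad r^{2n}=\prod_{1\leq i\leq j\leq k} r_{ij}^{2n_{ij}},$$ where the (internal) direct sum of subspaces is taken over all families $n=\{n_{ij}\}_{1\leq i\leq j\leq k}$ of non-negative integers $n_{ij}\in\mathbb{N}_0$.
   Context: Points of $(\mathbb{R}^m)^k$ are written $(x^1,\ldots,x^k)$ with $x^i=(x^i_1,\ldots,x^i_m)\in\mathbb{R}^m$ for $i=1,\ldots,k$ (upper indices label the vector variables and are not powers). $\mathcal{P}$ denotes the complex vector space of polynomials $P:(\mathbb{R}^m)^k\to\mathbb{C}$ in the $mk$ real variables $x^i_l$. For $i,j=1,\ldots,k$ put $$\Delta_{ij}=\partial_{x^i_1}\partial_{x^j_1}+\cdots+\partial_{x^i_m}\partial_{x^j_m},\qquad r^2_{ij}=x^i_1x^j_1+\cdots+x^i_mx^j_m,$$ so $\Delta_{ij}=\Delta_{ji}$ and $r^2_{ij}=r^2_{ji}$. Here $r_{ij}^2$ is a single symbol for a quadratic polynomial, and $r_{ij}^{2n_{ij}}=(r_{ij}^2)^{n_{ij}}$. The space of spherical harmonics is $\mathcal{H}=\{P\in\mathcal{P}:\Delta_{ij}P=0\text{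 for all }1\leq i\leq j\leq k\}$. For a polynomial $q$, $q\,\mathcal{H}=\{qH: H\in\mathcal{H}\}$. $\mathbb{N}_0=\{0,1,2,\ldots\}$. *)

theory Defs
  imports "HOL-Analysis.Analysis" "HOL-Library.Function_Algebras"
begin

text \<open>
  The space \<open>(\<real>\<^sup>m)\<^sup>k\<close> is \<^typ>\<open>real ^ 'm ^ 'k\<close>, so that the coordinate \<open>x\<^sup>i\<^sub>l\<close> is
  \<open>x $ i $ l\<close>.  The index type \<open>'k\<close> carries a linear order, which plays the role of the
  order on \<open>1, \<dots>, k\<close> in the condition \<open>i \<le> j\<close>.
\<close>

definition (in module) internal_direct_sum :: "'b set \<Rightarrow> 'i set \<Rightarrow> ('i \<Rightarrow> 'b set) \<Rightarrow> bool"
  where "internal_direct_sum V I W \<longleftrightarrow>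
    subspace V \<and> (\<forall>n\<in>I. subspace (W n) \<and> W n \<subseteq> V) \<and>
    (\<forall>p\<in>V. \<exists>!v. (\<forall>n\<in>I. v n \<in> W n) \<and> (\<forall>n. n \<notin> I \<longrightarrow> v n = 0) \<and>
                finite {n. v n \<noteq> 0} \<and> p = (\<Sum>n | v n \<noteq> 0. v n))"

global_interpretation cfun: vector_space "\<lambda>(c::complex) (f::'a \<Rightarrow> complex) x. c * f x"
  by unfold_locales (auto simp: fun_eq_iff algebra_simps)

definition polys :: "(real ^ 'm ^ 'k \<Rightarrow> complex) set"
  where "polys = {P. polynomial_function P}"

definition partial :: "'k \<Rightarrow> 'm \<Rightarrow> (real ^ 'm ^ 'k \<Rightarrow> complex) \<Rightarrow> real ^ 'm ^ 'k \<Rightarrow> complex"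
  where "partial i l P x = vector_derivative (\<lambda>t. P (x + t *\<^sub>R axis i (axis l 1))) (at 0)"

definition mixed_laplacian ::
    "'k \<Rightarrow> 'k \<Rightarrow> (real ^ 'm ^ 'k \<Rightarrow> complex) \<Rightarrow> real ^ 'm ^ 'k \<Rightarrow> complex"
  where "mixed_laplacian i j P x = (\<Sum>l\<in>UNIV. partial i l (partial j l P) x)"

definition harmonics :: "(real ^ 'm ^ 'k::{finite,linorder} \<Rightarrow> complex) set"
  where "harmonics = {P \<in> polys. \<forall>i j. i \<le> j \<longrightarrow> (\<forall>x. mixed_laplacian i j P x = 0)}"

definition rsq :: "'k \<Rightarrow> 'k \<Rightarrow> real ^ 'm ^ 'k \<Rightarrow> complex"
  where "rsq i j x = of_real (\<Sum>l\<in>UNIV. x $ i $ l * x $ j $ l)"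

definition index_pairs :: "('k::linorder \<times> 'k) set"
  where "index_pairs = {(i, j). i \<le> j}"

definition rsq_monomial ::
    "('k::{finite,linorder} \<times> 'k \<Rightarrow> nat) \<Rightarrow> real ^ 'm ^ 'k::{finite,linorder} \<Rightarrow> complex"
  where "rsq_monomial n x = (\<Prod>(i, j)\<in>index_pairs. rsq i j x ^ n (i, j))"

text \<open>
  A family \<open>n = {n\<^sub>i\<^sub>j}\<close> over \<open>i \<le> j\<close> is an extensional function on \<^const>\<open>index_pairs\<close>, so that
  distinct indices of the direct sum are exactly distinct families.
\<close>

definition exponent_families :: "('k::linorder \<times> 'k \<Rightarrow> nat) set"
  where "exponent_families = index_pairs \<rightarrow>\<^sub>E UNIV"

definition mult_space :: "('a \<Rightarrow> complex) \<Rightarrow> ('a \<Rightarrow> complex) set \<Rightarrow> ('a \<Rightarrow> complex) set"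
  where "mult_space q S = {\<lambda>x. q x * H x | H. H \<in> S}"

end

theory Submission
  imports Defs
begin

text \<open>
  Existence of the decomposition holds for all \<open>m\<close>: for the Fischer inner product
  multiplication by \<open>r\<^sup>2\<^sub>i\<^sub>j\<close> is adjoint to \<open>\<Delta>\<^sub>i\<^sub>j\<close>, so \<open>\<H>\<close> is the orthogonal complement of the ideal \<open>J\<close>
  generated by the \<open>r\<^sup>2\<^sub>i\<^sub>j\<close>, and one iterates \<open>\<P> = \<H> \<oplus> J\<close> on the degree.

  Uniqueness uses \<open>m \<ge> 2k - 1\<close>. Give \<open>x\<^sup>i\<^sub>l\<close> the weight \<open>- (l - (2i - 1))\<^sup>2\<close>. Then \<open>r\<^sup>2\<^sub>i\<^sub>j\<close> has the
  unique monomial \<open>x\<^sup>i\<^sub>l x\<^sup>j\<^sub>l\<close> with \<open>l = i + j - 1\<close> of maximal weight, and these leading monomials are pairwise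
  coprime. Hence every monomial is uniquely a product of leading monomials and a monomial divisible
  by none of them; replacing the leading monomials by the \<open>r\<^sup>2\<^sub>i\<^sub>j\<close> is a unitriangular change, so the
  products \<open>r\<^sup>2\<^sup>n x\<^sup>\<beta>\<close> with \<open>x\<^sup>\<beta>\<close> divisible by no leading monomial form a basis of \<open>\<P>\<close>. Given a
  relation \<open>\<Sum>\<^sub>n r\<^sup>2\<^sup>n H\<^sub>n = 0\<close>, comparing coordinates at an \<open>n\<close> of minimal size shows \<open>H\<^sub>n \<in> J\<close>, and
  \<open>\<H> \<inter> J = 0\<close>.
\<close>

section \<open>Independent families and their coordinates\<close>

text \<open>Injectivity of \<open>e\<close> lets coordinates be indexed by \<open>'i\<close> instead
  of by vectors, so that shifts of exponents act directly on coordinates.\<close>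

locale indep_family = vector_space scale
  for scale :: "'a::field \<Rightarrow> 'b::ab_group_add \<Rightarrow> 'b" +
  fixes e :: "'i \<Rightarrow> 'b"
  assumes inj: "inj e" and independent: "independent (range e)"

lemma (in vector_space) indep_familyI:
  assumes indep: "\<And>A c. finite A \<Longrightarrow> (\<Sum>i\<in>A. scale (c i) (e i)) = 0 \<Longrightarrow> \<forall>i\<in>A. c i = 0"
  shows "indep_family scale e"
proof
  show inj: "inj e"
  proof (rule injI, rule ccontr)
    \<comment> \<open>A repeated vector would satisfy the relation with coefficients 1 and
      -1.\<close>
    fix i j assume "e i = e j" "i \<noteq> j"
    then show False
      using indep[of "{i, j}" "\<lambda>l. if l = i then 1 else - 1"] by auto
  qed
  show "independent (range e)"
    unfolding independent_explicit_module
  proof (intro allI impI)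
    fix t u v
    assume t: "finite t" "t \<subseteq> range e" "(\<Sum>v\<in>t. scale (u v) v) = 0" "v \<in> t"
    have img: "t = e ` (e -` t)" using t by auto
    have fin: "finite (e -` t)" using t inj by (simp add: finite_vimageI)
    have "(\<Sum>i\<in>e -` t. scale (u (e i)) (e i)) = (\<Sum>v\<in>e ` (e -` t). scale (u v) v)"
      using inj_on_subset[OF inj subset_UNIV, of "e -` t"] by (simp only: sum.reindex comp_def)
    also have "\<dots> = 0" using t(3) by (simp only: img[symmetric])
    finally have "\<forall>i\<in>e -` t. u (e i) = 0" using indep[OF fin, of "u \<circ> e"] by simp
    with t show "u v = 0" by auto
  qed
qed

context indep_family
begin

text \<open>\<open>representation\<close> takes the value 0 off the span, so linearity of
  \<open>coord\<close> is stated only for arguments in the span.\<close>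

definition coord :: "'i \<Rightarrow> 'b \<Rightarrow> 'a"
  where "coord i p = representation (range e) p (e i)"

lemma coord_family: "coord i (e j) = (if i = j then 1 else 0)"
  using independent inj by (auto simp: coord_def representation_basis inj_eq)

lemma coord_zero [simp]: "coord i 0 = 0"
  by (simp add: coord_def representation_zero)

lemma coord_add:
  "p \<in> span (range e) \<Longrightarrow> q \<in> span (range e) \<Longrightarrow> coord i (p + q) = coord i p + coord i q"
  using independent by (simp add: coord_def representation_add)

lemma coord_scale: "p \<in> span (range e) \<Longrightarrow> coord i (scale c p) = c * coord i p"
  using independent by (simp add: coord_def representation_scale)

lemma coord_sum:
  "(\<And>j. j \<in> A \<Longrightarrow> p j \<in> span (range e)) \<Longrightarrow> coord i (\<Sum>j\<in>A. p j) = (\<Sum>j\<in>A. coord i (p j))"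
  using independent by (simp add: coord_def representation_sum)

lemma finite_coord: "finite {i. coord i p \<noteq> 0}"
proof -
  have "finite (e -` {b. representation (range e) p b \<noteq> 0})"
    by (intro finite_vimageI finite_representation inj)
  then show ?thesis by (simp add: coord_def vimage_def)
qed

lemma sum_coord:
  assumes "p \<in> span (range e)"
  shows "(\<Sum>i | coord i p \<noteq> 0. scale (coord i p) (e i)) = p"
proof -
  have img: "{b. representation (range e) p b \<noteq> 0} = e ` {i. coord i p \<noteq> 0}"
    using representation_ne_zero[of "range e" p] by (auto simp: coord_def)
  have "(\<Sum>b | representation (range e) p b \<noteq> 0. scale (representation (range e) p b) b) = p"
    using sum_nonzero_representation_eq[OF independent assms] .
  then show ?thesis
    unfolding img using inj_on_subset[OF inj subset_UNIV] by (simp only: sum.reindex comp_def coord_def)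
qed

lemma coord_span_image:
  assumes "p \<in> span (e ` S)" "i \<notin> S"
  shows "coord i p = 0"
proof -
  \<comment> \<open>Membership in the span is carried through the induction because additivity of
    \<open>coord\<close> requires it.\<close>
  have "p \<in> span (range e) \<and> coord i p = 0"
    using assms(1)
  proof (induction rule: span_induct_alt)
    case base
    then show ?case by (simp add: span_zero)
  next
    case (step c x y)
    then obtain j where j: "x = e j" "j \<in> S" by auto
    then have "x \<in> span (range e)" by (simp add: span_base)
    with step j assms(2) show ?case
      by (auto simp: coord_add coord_scale span_scale span_add coord_family)
  qed
  then show ?thesis by simp
qed

section \<open>Unitriangular change of an independent family\<close>

context
  fixes f :: "'i \<Rightarrow> 'b" and wt :: "'i \<Rightarrow> nat"
  assumes tri: "f i - e i \<in> span (e ` {j. wt j < wt i})"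
begin

lemma triangular_in_span: "f i \<in> span (range e)"
proof -
  have "f i - e i \<in> span (range e)"
    using tri[of i] span_mono[of "e ` {j. wt j < wt i}" "range e"] by auto
  from span_add[OF this span_base[of "e i"]] show ?thesis by simp
qed

text \<open>\<open>e i\<close> is \<open>f i\<close> minus a combination of members of strictly
  smaller weight, which strong induction on the weight has already placed in the span of
  \<open>f\<close>.\<close>

lemma triangular_spans: "e i \<in> span (range f)"
proof (induction i rule: measure_induct_rule[of wt])
  case (less i)
  then have "span (e ` {j. wt j < wt i}) \<subseteq> span (range f)"
    by (intro span_minimal) (auto simp: subspace_span)
  with tri[of i] have "f i - e i \<in> span (range f)" by blast
  from span_diff[OF span_base[of "f i"] this] show ?case by simp
qed

lemma triangular_indep: "indep_family scale f"
proof (rule indep_familyI)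
  fix A :: "'i set" and c
  assume A: "finite A" "(\<Sum>i\<in>A. scale (c i) (f i)) = 0"
  show "\<forall>i\<in>A. c i = 0"
  proof (rule ccontr)
    let ?B = "{i \<in> A. c i \<noteq> 0}"
    assume "\<not> (\<forall>i\<in>A. c i = 0)"
    then have "?B \<noteq> {}" "finite ?B" using A by auto
    then have "Max (wt ` ?B) \<in> wt ` ?B" by (intro Max_in) auto
    then obtain k where k_max: "Max (wt ` ?B) = wt k" and k: "k \<in> ?B" by (rule imageE)
    have max: "wt i \<le> wt k" if "i \<in> ?B" for i
      unfolding k_max[symmetric] by (rule Max_ge) (use A(1) that in auto)
    \<comment> \<open>\<open>k\<close> has maximal weight among the indices with non-zero
      coefficient. The tail \<open>f i - e i\<close> involves only weights below
      \<open>wt i \<le> wt k\<close>, hence never \<open>e k\<close>, so the coordinate at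
      \<open>k\<close> isolates \<open>c k\<close>.\<close>
    have top: "coord k (f i) = (if i = k then 1 else 0)" if "i \<in> ?B" for i
    proof -
      have "coord k (f i - e i) = 0"
        using coord_span_image[OF tri, of k i] max[OF that] by simp
      moreover have "f i - e i \<in> span (range e)"
        using triangular_in_span by (simp add: span_diff span_base)
      ultimately have "coord k (f i - e i + e i) = coord k (e i)"
        by (subst coord_add) (auto simp: span_base)
      then show ?thesis by (auto simp: coord_family)
    qed
    have "(\<Sum>i\<in>?B. scale (c i) (f i)) = (\<Sum>i\<in>A. scale (c i) (f i))"
      by (rule sum.mono_neutral_left) (use A in auto)
    then have "0 = coord k (\<Sum>i\<in>?B. scale (c i) (f i))" using A by simp
    also have "\<dots> = (\<Sum>i\<in>?B. c i * coord k (f i))"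
      by (subst coord_sum) (auto simp: triangular_in_span span_scale coord_scale)
    also have "\<dots> = (\<Sum>i\<in>?B. if i = k then c i else 0)"
      by (rule sum.cong) (auto simp: top)
    also have "\<dots> = c k" using k A by simp
    finally show False using k by simp
  qed
qed

end

end

section \<open>Monomials and partial derivatives\<close>

lemma sum_fun_apply: "(\<Sum>i\<in>A. f i) x = (\<Sum>i\<in>A. f i x)"
  by (induction A rule: infinite_finite_induct) auto

lemma prod_fun_apply: "(\<Prod>i\<in>A. f i) x = (\<Prod>i\<in>A. f i x)"
  by (induction A rule: infinite_finite_induct) auto

lemma power_fun_apply: "(f ^ n) x = f x ^ n"
  by (induction n) auto

definition var :: "'k \<times> 'm \<Rightarrow> real ^ 'm ^ 'k \<Rightarrow> complex"
  where "var v x = of_real (x $ fst v $ snd v)"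

definition mon :: "('k \<times> 'm \<Rightarrow> nat) \<Rightarrow> real ^ 'm ^ 'k \<Rightarrow> complex"
  where "mon \<alpha> x = (\<Prod>v\<in>UNIV. var v x ^ \<alpha> v)"

definition unit_exp :: "'v \<Rightarrow> 'v \<Rightarrow> nat"
  where "unit_exp v = (\<lambda>u. if u = v then 1 else 0)"

definition deg :: "('v \<Rightarrow> nat) \<Rightarrow> nat"
  where "deg \<alpha> = (\<Sum>v\<in>UNIV. \<alpha> v)"

lemma mon_add: "mon (\<alpha> + \<beta>) = mon \<alpha> * mon \<beta>"
  by (auto simp: mon_def fun_eq_iff power_add prod.distrib)

lemma mon_zero [simp]: "mon 0 = 1"
  by (auto simp: mon_def fun_eq_iff)

lemma mon_unit_exp: "mon (unit_exp v) = var v"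
proof
  fix x
  have "mon (unit_exp v) x = (\<Prod>u\<in>UNIV. if u = v then var u x else 1)"
    unfolding mon_def unit_exp_def by (rule prod.cong) auto
  then show "mon (unit_exp v) x = var v x" by simp
qed

lemma deg_add: "deg (\<alpha> + \<beta>) = deg \<alpha> + deg \<beta>"
  by (simp add: deg_def sum.distrib)

lemma deg_unit_exp [simp]: "deg (unit_exp (v :: 'v::finite)) = 1"
  by (simp add: deg_def unit_exp_def)

lemma unit_exp_add_diff: "\<alpha> v > 0 \<Longrightarrow> unit_exp v + (\<alpha> - unit_exp v) = \<alpha>"
  by (auto simp: fun_eq_iff unit_exp_def)

lemma finite_deg_le: "finite {\<alpha> :: 'v::finite \<Rightarrow> nat. deg \<alpha> \<le> d}"
proof (rule finite_subset)
  show "{\<alpha> :: 'v \<Rightarrow> nat. deg \<alpha> \<le> d} \<subseteq> PiE UNIV (\<lambda>_. {..d})"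
  proof
    fix \<alpha> :: "'v \<Rightarrow> nat" assume "\<alpha> \<in> {\<alpha>. deg \<alpha> \<le> d}"
    then have "\<alpha> v \<le> d" for v using member_le_sum[of v UNIV \<alpha>] by (simp add: deg_def)
    then show "\<alpha> \<in> PiE UNIV (\<lambda>_. {..d})" by auto
  qed
qed (simp add: finite_PiE)

text \<open>With the exponent sets kept abstract, one statement serves both the multiplicative
  closure of \<open>polys\<close> and the strict weight bounds for leading monomials.\<close>

lemma span_mon_mult:
  assumes ST: "\<And>\<alpha> \<beta>. \<alpha> \<in> S \<Longrightarrow> \<beta> \<in> T \<Longrightarrow> \<alpha> + \<beta> \<in> U"
    and p: "p \<in> cfun.span (mon ` S)" and q: "q \<in> cfun.span (mon ` T)"
  shows "p * q \<in> cfun.span (mon ` U)"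
proof -
  have mono: "mon \<alpha> * q \<in> cfun.span (mon ` U)" if "\<alpha> \<in> S" for \<alpha>
    using q
  proof (induction rule: cfun.span_induct_alt)
    case base
    show ?case using cfun.span_zero by (simp add: zero_fun_def)
  next
    case (step c a y)
    then obtain \<beta> where "a = mon \<beta>" "\<beta> \<in> T" by auto
    then have "mon \<alpha> * a \<in> cfun.span (mon ` U)"
      using ST that by (auto simp: mon_add[symmetric] intro: cfun.span_base)
    from cfun.span_add[OF cfun.span_scale[OF this, of c] step(2)] show ?case
      by (simp add: plus_fun_def times_fun_def algebra_simps)
  qed
  show ?thesis using p
  proof (induction rule: cfun.span_induct_alt)
    case base
    show ?case using cfun.span_zero by (simp add: zero_fun_def)
  next
    case (step c a y)
    then have "a * q \<in> cfun.span (mon ` U)" using mono by auto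
    from cfun.span_add[OF cfun.span_scale[OF this, of c] step(2)] show ?case
      by (simp add: plus_fun_def times_fun_def algebra_simps)
  qed
qed

section \<open>Polynomial functions as combinations of monomials\<close>

lemma real_polynomial_function_cspan:
  fixes p :: "real ^ 'm ^ 'k \<Rightarrow> real"
  assumes "real_polynomial_function p"
  shows "(\<lambda>x. complex_of_real (p x)) \<in> cfun.span (range mon)"
  using assms
proof (induction rule: real_polynomial_function.induct)
  case (linear f)
  interpret bounded_linear f by fact
  \<comment> \<open>A linear functional is expanded in the standard basis, whose coordinate
    functions are the variables, that is, monomials of degree one.\<close>
  have f_eq: "f x = (\<Sum>b\<in>Basis. f b * (x \<bullet> b))" for x
  proof -
    have "f x = f (\<Sum>b\<in>Basis. (x \<bullet> b) *\<^sub>R b)" by (simp add: euclidean_representation)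
    then show ?thesis by (simp add: sum scaleR mult.commute)
  qed
  have "(\<lambda>x. complex_of_real (f x)) =
      (\<Sum>b\<in>Basis. (\<lambda>x. of_real (f b) * of_real (x \<bullet> b)))"
    by (rule ext) (subst f_eq, simp add: sum_fun_apply)
  moreover have "(\<lambda>x :: real ^ 'm ^ 'k. complex_of_real (x \<bullet> b)) \<in> cfun.span (range mon)"
    if "b \<in> Basis" for b
  proof -
    from that obtain i l where "b = axis i (axis l 1)" by (auto simp: Basis_vec_def)
    then have "(\<lambda>x :: real ^ 'm ^ 'k. complex_of_real (x \<bullet> b)) = mon (unit_exp (i, l))"
      by (simp add: inner_axis mon_unit_exp var_def fun_eq_iff)
    then show ?thesis by (simp add: cfun.span_base)
  qed
  ultimately show ?case by (simp add: cfun.span_sum cfun.span_scale)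
next
  case (const c)
  have "(\<lambda>x. complex_of_real c * mon 0 x) \<in> cfun.span (range mon)"
    by (rule cfun.span_scale[OF cfun.span_base[OF rangeI]])
  then show ?case by simp
next
  case (add f g)
  from cfun.span_add[OF add.IH] show ?case by (simp add: plus_fun_def)
next
  case (mult f g)
  from span_mon_mult[OF _ mult.IH, of UNIV] show ?case by (simp add: times_fun_def)
qed

text \<open>\<open>polynomial_function\<close> tests a vector-valued map through real bounded linear
  functionals; \<open>Re\<close> and \<open>Im\<close> already recover \<open>P\<close>. Conversely,
  a complex multiple of a monomial is a real polynomial times a constant vector.\<close>

lemma polys_eq_span: "polys = cfun.span (range mon)"
proof (intro equalityI subsetI)
  fix P :: "real ^ 'm ^ 'k \<Rightarrow> complex"
  assume "P \<in> polys"
  then have P: "real_polynomial_function (\<lambda>x. Re (P x))" "real_polynomial_function (\<lambda>x. Im (P x))"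
    using bounded_linear_Re bounded_linear_Im
    by (auto simp: polys_def polynomial_function_def comp_def)
  have "(\<lambda>x. of_real (Re (P x))) + (\<lambda>x. \<i> * of_real (Im (P x))) \<in> cfun.span (range mon)"
    by (intro cfun.span_add cfun.span_scale real_polynomial_function_cspan P)
  also have "(\<lambda>x. of_real (Re (P x))) + (\<lambda>x. \<i> * of_real (Im (P x))) = P"
    by (auto simp: fun_eq_iff complex_eq_iff)
  finally show "P \<in> cfun.span (range mon)" .
next
  fix P :: "real ^ 'm ^ 'k \<Rightarrow> complex"
  assume "P \<in> cfun.span (range mon)"
  then show "P \<in> polys"
  proof (induction rule: cfun.span_induct_alt)
    case base
    then show ?case by (simp add: polys_def zero_fun_def)
  next
    case (step c a y)
    then obtain \<alpha> where a: "a = mon \<alpha>" by auto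
    have "bounded_linear (\<lambda>x :: real ^ 'm ^ 'k. x $ i $ l)" for i l
      by (intro bounded_linear_compose[OF bounded_linear_vec_nth bounded_linear_vec_nth])
    then have real: "real_polynomial_function (\<lambda>x :: real ^ 'm ^ 'k. \<Prod>v\<in>UNIV. (x $ fst v $ snd v) ^ \<alpha> v)"
      by (intro real_polynomial_function_prod real_polynomial_function_power
          real_polynomial_function.intros(1)) auto
    have "polynomial_function (\<lambda>x :: real ^ 'm ^ 'k. (\<Prod>v\<in>UNIV. (x $ fst v $ snd v) ^ \<alpha> v) *\<^sub>R c)"
      using real by (intro polynomial_function_mult) (simp_all add: real_polynomial_function_eq)
    also have "(\<lambda>x. (\<Prod>v\<in>UNIV. (x $ fst v $ snd v) ^ \<alpha> v) *\<^sub>R c) = (\<lambda>x. c * a x)"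
      by (simp add: a mon_def var_def fun_eq_iff scaleR_conv_of_real mult.commute)
    finally have "polynomial_function (\<lambda>x. c * a x)" .
    with step show ?case by (auto simp: polys_def plus_fun_def)
  qed
qed

lemma subspace_polys: "cfun.subspace polys"
  by (simp add: polys_eq_span cfun.subspace_span)

lemmas polys_zero = cfun.subspace_0[OF subspace_polys]
  and polys_add = cfun.subspace_add[OF subspace_polys]
  and polys_diff = cfun.subspace_diff[OF subspace_polys]
  and polys_scale = cfun.subspace_scale[OF subspace_polys]
  and polys_sum = cfun.subspace_sum[OF subspace_polys]

lemma mon_in_polys [simp]: "mon \<alpha> \<in> polys"
  by (simp add: polys_eq_span cfun.span_base)

lemma var_in_polys [simp]: "var v \<in> polys"
  by (metis mon_unit_exp mon_in_polys)

lemma polys_mult: "p \<in> polys \<Longrightarrow> q \<in> polys \<Longrightarrow> p * q \<in> polys"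
  unfolding polys_eq_span by (rule span_mon_mult) auto

text \<open>The step also supplies \<open>q \<in> polys\<close>, since differentiation and the
  Fischer product are shown to be additive only on polynomials.\<close>

lemma polys_induct [consumes 1, case_names zero step]:
  assumes "p \<in> polys" "Q 0"
    and "\<And>c \<alpha> q. q \<in> polys \<Longrightarrow> Q q \<Longrightarrow> Q ((\<lambda>x. c * mon \<alpha> x) + q)"
  shows "Q p"
proof -
  have "p \<in> cfun.span (range mon)" using assms(1) by (simp add: polys_eq_span)
  then have "p \<in> polys \<and> Q p"
  proof (induction rule: cfun.span_induct_alt)
    case base
    show ?case by (intro conjI polys_zero assms(2))
  next
    case (step c a q)
    then show ?case by (blast intro: polys_add polys_scale assms(3) mon_in_polys)
  qed
  then show ?thesis ..
qed

section \<open>Partial derivatives of polynomials\<close>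

lemma partial_has_vector_derivative:
  assumes "p \<in> polys"
  shows "((\<lambda>t. p (x + t *\<^sub>R axis i (axis l 1))) has_vector_derivative partial i l p x) (at 0)"
proof -
  \<comment> \<open>Along a line, a polynomial is a polynomial in one real variable, hence
    differentiable; so \<open>partial\<close> is a true derivative and not a default value.\<close>
  have "polynomial_function (\<lambda>t::real. x + t *\<^sub>R axis i (axis l 1))"
    by (intro polynomial_function_add polynomial_function_mult) auto
  then have "polynomial_function (\<lambda>t. p (x + t *\<^sub>R axis i (axis l 1)))"
    using polynomial_function_compose[of "\<lambda>t. x + t *\<^sub>R axis i (axis l 1)" p] assms
    by (simp add: polys_def comp_def)
  then obtain p' :: "real \<Rightarrow> complex" where "polynomial_function p'"
    and "\<And>s. ((\<lambda>t. p (x + t *\<^sub>R axis i (axis l 1))) has_vector_derivative p' s) (at s)"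
    by (rule has_vector_derivative_polynomial_function) blast
  from this(2)[of 0] show ?thesis by (simp add: partial_def vector_derivative_at)
qed

lemma partial_eqI:
  "(\<And>x. ((\<lambda>t. p (x + t *\<^sub>R axis i (axis l 1))) has_vector_derivative p' x) (at 0)) \<Longrightarrow> partial i l p = p'"
  by (auto simp: fun_eq_iff partial_def vector_derivative_at)

lemma partial_add: "p \<in> polys \<Longrightarrow> q \<in> polys \<Longrightarrow> partial i l (p + q) = partial i l p + partial i l q"
  by (rule partial_eqI) (auto intro!: has_vector_derivative_add partial_has_vector_derivative)

lemma partial_scale: "p \<in> polys \<Longrightarrow> partial i l (\<lambda>x. c * p x) = (\<lambda>x. c * partial i l p x)"
  by (rule partial_eqI) (auto intro!: has_vector_derivative_mult_right partial_has_vector_derivative)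

lemma partial_zero [simp]: "partial i l 0 = 0"
  by (rule partial_eqI) auto

lemma partial_sum:
  "(\<And>j. j \<in> A \<Longrightarrow> p j \<in> polys) \<Longrightarrow> partial i l (\<Sum>j\<in>A. p j) = (\<Sum>j\<in>A. partial i l (p j))"
  by (induction A rule: infinite_finite_induct) (auto simp: partial_add polys_sum)

lemma partial_mon:
  fixes \<alpha> :: "'k::finite \<times> 'm::finite \<Rightarrow> nat"
  shows "partial i l (mon \<alpha>) = (\<lambda>x. of_nat (\<alpha> (i, l)) * mon (\<alpha> - unit_exp (i, l)) x)"
proof (rule partial_eqI)
  fix x :: "real ^ 'm ^ 'k"
  \<comment> \<open>\<open>R\<close> collects the factors that stay constant along the line, which
    leaves the derivative of a power of one real variable. When \<open>\<alpha> (i, l) = 0\<close>,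
    the coefficient 0 makes the truncated exponent harmless.\<close>
  define R where "R = (\<Prod>u\<in>UNIV - {(i, l)}. var u x ^ \<alpha> u)"
  have coord: "var u (x + t *\<^sub>R axis i (axis l 1)) = var u x + (if u = (i, l) then of_real t else 0)"
    for u t by (cases u) (auto simp: var_def axis_def)
  have "mon \<alpha> (x + t *\<^sub>R axis i (axis l 1)) = of_real (x $ i $ l + t) ^ \<alpha> (i, l) * R" for t
    unfolding mon_def coord R_def
    by (subst prod.remove[of UNIV "(i, l)"]) (auto simp: var_def intro!: prod.cong)
  moreover have "mon (\<alpha> - unit_exp (i, l)) x = of_real (x $ i $ l) ^ (\<alpha> (i, l) - 1) * R"
    unfolding mon_def R_def
    by (subst prod.remove[of UNIV "(i, l)"]) (auto simp: var_def unit_exp_def intro!: prod.cong)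
  moreover have "((\<lambda>t. (x $ i $ l + t) ^ \<alpha> (i, l)) has_real_derivative
      (of_nat (\<alpha> (i, l)) * (x $ i $ l) ^ (\<alpha> (i, l) - 1))) (at 0)"
    by (auto intro!: derivative_eq_intros)
  then have "((\<lambda>t. of_real ((x $ i $ l + t) ^ \<alpha> (i, l)) * R) has_vector_derivative
      (of_real (of_nat (\<alpha> (i, l)) * (x $ i $ l) ^ (\<alpha> (i, l) - 1)) * R)) (at 0)"
    by (intro has_vector_derivative_mult_left has_vector_derivative_of_real)
  ultimately show "((\<lambda>t. mon \<alpha> (x + t *\<^sub>R axis i (axis l 1))) has_vector_derivative
      of_nat (\<alpha> (i, l)) * mon (\<alpha> - unit_exp (i, l)) x) (at 0)"
    by (simp add: mult.assoc)
qed

section \<open>Linear independence of the monomials\<close>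

lemma mon_indep:
  fixes c :: "('k::finite \<times> 'm::finite \<Rightarrow> nat) \<Rightarrow> complex"
  assumes "finite A" "\<And>\<alpha>. \<alpha> \<in> A \<Longrightarrow> deg \<alpha> \<le> d" "(\<Sum>\<alpha>\<in>A. (\<lambda>x. c \<alpha> * mon \<alpha> x)) = 0"
  shows "\<forall>\<alpha>\<in>A. c \<alpha> = 0"
  using assms
proof (induction d arbitrary: A c rule: less_induct)
  case (less d)
  \<comment> \<open>Differentiating the relation lowers the degree by one and keeps the surviving
    monomials distinct, so the induction hypothesis kills every coefficient whose exponent is
    positive at \<open>(i, l)\<close>. Only the constant term then remains.\<close>
  have nonconst: "c \<alpha> = 0" if \<alpha>: "\<alpha> \<in> A" "\<alpha> (i, l) > 0" for \<alpha> i l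
  proof -
    let ?u = "unit_exp (i, l)"
    let ?A = "{\<alpha> \<in> A. \<alpha> (i, l) > 0}"
    let ?B = "(\<lambda>\<alpha>. \<alpha> - ?u) ` ?A"
    \<comment> \<open>In the derivative, \<open>mon \<beta>\<close> comes from
      \<open>?u + \<beta>\<close> alone, with the factor \<open>\<beta> (i, l) + 1\<close>; this
      factor is non-zero and is cancelled at the end.\<close>
    define c' where "c' = (\<lambda>\<beta>. c (?u + \<beta>) * of_nat (Suc (\<beta> (i, l))))"
    have inj: "inj_on (\<lambda>\<alpha>. \<alpha> - ?u) ?A"
      by (rule inj_onI) (metis (mono_tags, lifting) mem_Collect_eq unit_exp_add_diff)
    have deg': "deg \<alpha> = Suc (deg (\<alpha> - ?u))" if "\<alpha> \<in> ?A" for \<alpha>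
      using deg_add[of ?u "\<alpha> - ?u"] that by (simp add: unit_exp_add_diff)
    have "d > 0" using deg'[of \<alpha>] less.prems(2)[of \<alpha>] \<alpha> by simp
    have "0 = partial i l (\<Sum>\<alpha>\<in>A. (\<lambda>x. c \<alpha> * mon \<alpha> x))" by (simp only: less.prems partial_zero)
    also have "\<dots> = (\<Sum>\<alpha>\<in>A. (\<lambda>x. c \<alpha> * (of_nat (\<alpha> (i, l)) * mon (\<alpha> - ?u) x)))"
      by (simp add: partial_sum polys_scale partial_scale partial_mon)
    also have "\<dots> = (\<Sum>\<alpha>\<in>?A. (\<lambda>x. c \<alpha> * (of_nat (\<alpha> (i, l)) * mon (\<alpha> - ?u) x)))"
      by (rule sum.mono_neutral_right) (use less.prems(1) in \<open>auto simp: fun_eq_iff\<close>)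
    also have "\<dots> = (\<Sum>\<alpha>\<in>?A. (\<lambda>x. c' (\<alpha> - ?u) * mon (\<alpha> - ?u) x))"
    proof (rule sum.cong)
      fix \<alpha> assume "\<alpha> \<in> ?A"
      then have "?u + (\<alpha> - ?u) = \<alpha>" "Suc ((\<alpha> - ?u) (i, l)) = \<alpha> (i, l)"
        by (auto simp: unit_exp_add_diff unit_exp_def)
      then show "(\<lambda>x. c \<alpha> * (of_nat (\<alpha> (i, l)) * mon (\<alpha> - ?u) x)) = (\<lambda>x. c' (\<alpha> - ?u) * mon (\<alpha> - ?u) x)"
        unfolding c'_def by (simp only: mult.assoc)
    qed simp
    also have "\<dots> = (\<Sum>\<beta>\<in>?B. (\<lambda>x. c' \<beta> * mon \<beta> x))"
      by (simp only: sum.reindex[OF inj] comp_def)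
    finally have sum0: "(\<Sum>\<beta>\<in>?B. (\<lambda>x. c' \<beta> * mon \<beta> x)) = 0" by (rule sym)
    have "\<forall>\<beta>\<in>?B. c' \<beta> = 0"
    proof (rule less.IH[OF _ _ _ sum0])
      show "d - 1 < d" using \<open>d > 0\<close> by simp
      show "finite ?B" using less.prems(1) by simp
      fix \<beta> assume "\<beta> \<in> ?B"
      then obtain \<gamma> where \<gamma>: "\<gamma> \<in> ?A" "\<beta> = \<gamma> - ?u" by blast
      then show "deg \<beta> \<le> d - 1" using deg'[OF \<gamma>(1)] less.prems(2)[of \<gamma>] by simp
    qed
    then have "c' (\<alpha> - ?u) = 0" using \<alpha> by blast
    then show ?thesis using \<alpha> by (simp add: c'_def unit_exp_add_diff del: of_nat_Suc)
  qed
  show ?case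
  proof
    fix \<alpha> assume \<alpha>: "\<alpha> \<in> A"
    show "c \<alpha> = 0"
    proof (cases "\<alpha> = 0")
      case True
      have "c \<beta> = 0" if "\<beta> \<in> A - {0}" for \<beta>
      proof -
        from that obtain v where "\<beta> v > 0" by (auto simp: fun_eq_iff)
        then show ?thesis using nonconst[of \<beta> "fst v" "snd v"] that by simp
      qed
      then have "(\<Sum>\<beta>\<in>A. (\<lambda>x. c \<beta> * mon \<beta> x)) = (\<lambda>x. c 0 * mon 0 x)"
        using \<alpha> True less.prems(1)
        by (subst sum.remove[of A 0]) (auto simp: fun_eq_iff sum_fun_apply)
      then have "c 0 = 0" using less.prems(3) by (simp add: fun_eq_iff)
      then show ?thesis using True by simp
    next
      case False
      then obtain v where "\<alpha> v > 0" by (auto simp: fun_eq_iff)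
      then show ?thesis using nonconst[of \<alpha> "fst v" "snd v"] \<alpha> by simp
    qed
  qed
qed

global_interpretation mon: indep_family "\<lambda>(c::complex) (f :: real ^ 'm ^ 'k \<Rightarrow> complex) x. c * f x" mon
  defines coef = mon.coord
proof (rule cfun.indep_familyI)
  fix A and c :: "('k \<times> 'm \<Rightarrow> nat) \<Rightarrow> complex"
  assume A: "finite A" "(\<Sum>\<alpha>\<in>A. (\<lambda>x. c \<alpha> * mon \<alpha> x)) = 0"
  have "deg \<alpha> \<le> Max (deg ` A)" if "\<alpha> \<in> A" for \<alpha> using A that by simp
  from mon_indep[OF A(1) this A(2)] show "\<forall>\<alpha>\<in>A. c \<alpha> = 0" by simp
qed

section \<open>The Fischer inner product\<close>

lemmas coef_add = mon.coord_add[folded polys_eq_span]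
  and coef_scale = mon.coord_scale[folded polys_eq_span]
  and sum_coef = mon.sum_coord[folded polys_eq_span]

definition exp_fact :: "('v \<Rightarrow> nat) \<Rightarrow> real"
  where "exp_fact \<alpha> = (\<Prod>v\<in>UNIV. fact (\<alpha> v))"

text \<open>The Fischer inner product, conjugate-linear in the second argument on polynomials.
  Summing over the support of \<open>p\<close> keeps the sum finite, and any finite superset gives
  the same value.\<close>

definition fischer :: "(real ^ 'm ^ 'k \<Rightarrow> complex) \<Rightarrow> (real ^ 'm ^ 'k \<Rightarrow> complex) \<Rightarrow> complex"
  where "fischer p q = (\<Sum>\<alpha> | coef \<alpha> p \<noteq> 0. of_real (exp_fact \<alpha>) * coef \<alpha> p * cnj (coef \<alpha> q))"

lemma exp_fact_pos: "exp_fact \<alpha> > 0"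
  by (auto simp: exp_fact_def intro!: prod_pos)

text \<open>This recursion for the factorial weights is what makes multiplication by a variable
  adjoint to its derivative.\<close>

lemma exp_fact_unit_exp:
  fixes \<alpha> :: "'v::finite \<Rightarrow> nat"
  shows "exp_fact (unit_exp v + \<alpha>) = of_nat (Suc (\<alpha> v)) * exp_fact \<alpha>"
proof -
  have "exp_fact (unit_exp v + \<alpha>) = fact (Suc (\<alpha> v)) * (\<Prod>u\<in>UNIV - {v}. fact (\<alpha> u))"
    unfolding exp_fact_def by (subst prod.remove[of UNIV v]) (auto simp: unit_exp_def intro!: prod.cong)
  moreover have "exp_fact \<alpha> = fact (\<alpha> v) * (\<Prod>u\<in>UNIV - {v}. fact (\<alpha> u))"
    unfolding exp_fact_def by (subst prod.remove[of UNIV v]) auto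
  ultimately show ?thesis by simp
qed

lemma fischer_eq_sum:
  assumes "finite A" "{\<alpha>. coef \<alpha> p \<noteq> 0} \<subseteq> A"
  shows "fischer p q = (\<Sum>\<alpha>\<in>A. of_real (exp_fact \<alpha>) * coef \<alpha> p * cnj (coef \<alpha> q))"
  unfolding fischer_def by (rule sum.mono_neutral_left) (use assms in auto)

lemma fischer_commute: "fischer q p = cnj (fischer p q)"
proof -
  let ?A = "{\<alpha>. coef \<alpha> p \<noteq> 0} \<union> {\<alpha>. coef \<alpha> q \<noteq> 0}"
  have "finite ?A" by (simp add: mon.finite_coord)
  then show ?thesis
    by (subst (1 2) fischer_eq_sum[of ?A]) (auto intro!: sum.cong)
qed

lemma fischer_add_left:
  assumes "p \<in> polys" "q \<in> polys"
  shows "fischer (p + q) r = fischer p r + fischer q r"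
proof -
  let ?A = "{\<alpha>. coef \<alpha> p \<noteq> 0} \<union> {\<alpha>. coef \<alpha> q \<noteq> 0}"
  have "finite ?A" by (simp add: mon.finite_coord)
  moreover have "{\<alpha>. coef \<alpha> (p + q) \<noteq> 0} \<subseteq> ?A" using assms by (auto simp: coef_add)
  ultimately show ?thesis
    using assms
    by (subst (1 2 3) fischer_eq_sum[of ?A]) (auto simp: sum.distrib[symmetric] coef_add algebra_simps)
qed

lemma fischer_scale_left:
  assumes "p \<in> polys"
  shows "fischer (\<lambda>x. c * p x) r = c * fischer p r"
proof -
  have "{\<alpha>. coef \<alpha> (\<lambda>x. c * p x) \<noteq> 0} \<subseteq> {\<alpha>. coef \<alpha> p \<noteq> 0}" using assms by (auto simp: coef_scale)
  then show ?thesis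
    using assms mon.finite_coord[of p]
    by (subst (1 2) fischer_eq_sum[of "{\<alpha>. coef \<alpha> p \<noteq> 0}"])
      (auto simp: sum_distrib_left coef_scale algebra_simps)
qed

lemma fischer_add_right:
  "p \<in> polys \<Longrightarrow> q \<in> polys \<Longrightarrow> fischer r (p + q) = fischer r p + fischer r q"
  by (simp only: fischer_commute[of r] fischer_add_left complex_cnj_add)

lemma fischer_scale_right: "p \<in> polys \<Longrightarrow> fischer r (\<lambda>x. c * p x) = cnj c * fischer r p"
  by (simp only: fischer_commute[of r] fischer_scale_left complex_cnj_mult)

lemma fischer_zero_left [simp]: "fischer 0 r = 0"
  by (simp add: fischer_def)

lemma fischer_zero_right [simp]: "fischer r 0 = 0"
  by (simp add: fischer_def)

lemma fischer_sum_left: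
  "(\<And>j. j \<in> A \<Longrightarrow> p j \<in> polys) \<Longrightarrow> fischer (\<Sum>j\<in>A. p j) r = (\<Sum>j\<in>A. fischer (p j) r)"
  by (induction A rule: infinite_finite_induct) (auto simp: fischer_add_left polys_sum)

lemma fischer_sum_right:
  "(\<And>j. j \<in> A \<Longrightarrow> p j \<in> polys) \<Longrightarrow> fischer r (\<Sum>j\<in>A. p j) = (\<Sum>j\<in>A. fischer r (p j))"
  by (induction A rule: infinite_finite_induct) (auto simp: fischer_add_right polys_sum)

lemma fischer_mon: "fischer (mon \<alpha>) (mon \<beta>) = (if \<alpha> = \<beta> then of_real (exp_fact \<alpha>) else 0)"
  by (subst fischer_eq_sum[of "{\<alpha>}"]) (auto simp: mon.coord_family split: if_splits)

lemma fischer_definite: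
  assumes "p \<in> polys" "fischer p p = 0"
  shows "p = 0"
proof -
  let ?A = "{\<alpha>. coef \<alpha> p \<noteq> 0}"
  have eq: "fischer p p = of_real (\<Sum>\<alpha>\<in>?A. exp_fact \<alpha> * (cmod (coef \<alpha> p))\<^sup>2)"
    unfolding fischer_def of_real_sum
    by (rule sum.cong) (simp_all only: of_real_mult complex_norm_square mult.assoc)
  have "(\<Sum>\<alpha>\<in>?A. exp_fact \<alpha> * (cmod (coef \<alpha> p))\<^sup>2) = 0"
    using trans[OF eq[symmetric] assms(2)] by (simp only: of_real_eq_0_iff)
  then have "\<forall>\<alpha>\<in>?A. exp_fact \<alpha> * (cmod (coef \<alpha> p))\<^sup>2 = 0"
    by (subst (asm) sum_nonneg_eq_0_iff) (auto simp: mon.finite_coord exp_fact_pos less_imp_le)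
  then have "?A = {}" using exp_fact_pos by (auto simp: less_le)
  then show ?thesis using sum_coef[OF assms(1)] by simp
qed

text \<open>The bound is written \<open>deg \<alpha> + n \<le> d\<close> instead of
  \<open>deg \<alpha> \<le> d - n\<close>: for \<open>n > d\<close> the space is zero, and each
  derivative raises \<open>n\<close> by one without truncated subtraction.\<close>

lemma partial_span_deg:
  assumes "p \<in> cfun.span (mon ` {\<alpha>. deg \<alpha> + n \<le> d})"
  shows "partial i l p \<in> cfun.span (mon ` {\<alpha>. deg \<alpha> + Suc n \<le> d})"
proof -
  have "p \<in> polys \<and> partial i l p \<in> cfun.span (mon ` {\<alpha>. deg \<alpha> + Suc n \<le> d})"
    using assms
  proof (induction rule: cfun.span_induct_alt)
    case base
    show ?case unfolding partial_zero by (intro conjI polys_zero cfun.span_zero)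
  next
    case (step c a y)
    then obtain \<alpha> where \<alpha>: "a = mon \<alpha>" "deg \<alpha> + n \<le> d" by auto
    have "(\<lambda>x. of_nat (\<alpha> (i, l)) * mon (\<alpha> - unit_exp (i, l)) x)
        \<in> cfun.span (mon ` {\<alpha>. deg \<alpha> + Suc n \<le> d})"
    proof (cases "\<alpha> (i, l) = 0")
      case True
      then show ?thesis using cfun.span_zero by (simp add: zero_fun_def)
    next
      case False
      then have "deg \<alpha> = Suc (deg (\<alpha> - unit_exp (i, l)))"
        using deg_add[of "unit_exp (i, l)" "\<alpha> - unit_exp (i, l)"] by (simp add: unit_exp_add_diff)
      then show ?thesis using \<alpha>(2) by (intro cfun.span_scale[OF cfun.span_base[OF imageI[of "\<alpha> - unit_exp (i, l)"]]]) simp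
    qed
    then have "partial i l a \<in> cfun.span (mon ` {\<alpha>. deg \<alpha> + Suc n \<le> d})"
      by (simp only: \<alpha> partial_mon)
    moreover have "a \<in> polys" by (simp add: \<alpha>)
    ultimately show ?case
      using step.IH by (simp only: partial_add partial_scale polys_scale polys_add cfun.span_add cfun.span_scale)
  qed
  then show ?thesis ..
qed

lemma polys_deg:
  assumes "p \<in> polys"
  obtains d where "p \<in> cfun.span (mon ` {\<alpha>. deg \<alpha> \<le> d})"
proof -
  let ?A = "{\<alpha>. coef \<alpha> p \<noteq> 0}"
  have "deg \<alpha> \<le> Max (deg ` ?A)" if "\<alpha> \<in> ?A" for \<alpha>
    using that by (intro Max_ge finite_imageI mon.finite_coord) auto
  then have "(\<Sum>\<alpha>\<in>?A. (\<lambda>x. coef \<alpha> p * mon \<alpha> x)) \<in> cfun.span (mon ` {\<alpha>. deg \<alpha> \<le> Max (deg ` ?A)})"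
    by (intro cfun.span_sum cfun.span_scale[OF cfun.span_base[OF imageI]]) simp
  then show ?thesis using that by (simp only: sum_coef[OF assms])
qed

lemma partial_in_polys: "p \<in> polys \<Longrightarrow> partial i l p \<in> polys"
proof -
  assume "p \<in> polys"
  then obtain d where "p \<in> cfun.span (mon ` {\<alpha>. deg \<alpha> \<le> d})" by (rule polys_deg)
  then have "p \<in> cfun.span (mon ` {\<alpha>. deg \<alpha> + 0 \<le> d})" by simp
  from partial_span_deg[OF this] show ?thesis
    unfolding polys_eq_span using cfun.span_mono[of "mon ` _" "range mon"] by blast
qed

section \<open>Adjoints of multiplication operators\<close>

lemma fischer_var_mon:
  fixes \<alpha> \<beta> :: "'k::finite \<times> 'm::finite \<Rightarrow> nat"
  shows "fischer (var (i, l) * mon \<alpha>) (mon \<beta>) = fischer (mon \<alpha>) (partial i l (mon \<beta>))"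
proof -
  let ?u = "unit_exp (i, l)"
  have lhs: "fischer (var (i, l) * mon \<alpha>) (mon \<beta>) = (if ?u + \<alpha> = \<beta> then of_real (exp_fact \<beta>) else 0)"
    by (simp add: mon_unit_exp[symmetric] mon_add[symmetric] fischer_mon)
  have rhs: "fischer (mon \<alpha>) (partial i l (mon \<beta>)) =
      of_nat (\<beta> (i, l)) * (if \<alpha> = \<beta> - ?u then of_real (exp_fact \<alpha>) else 0)"
    by (simp add: partial_mon fischer_scale_right fischer_mon)
  show ?thesis
  proof (cases "?u + \<alpha> = \<beta>")
    case True
    have "\<beta> - ?u = \<alpha>" "\<beta> (i, l) = Suc (\<alpha> (i, l))"
      unfolding True[symmetric] by (auto simp: unit_exp_def)
    then show ?thesis
      unfolding lhs rhs by (simp add: exp_fact_unit_exp True[symmetric])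
  next
    case False
    \<comment> \<open>Either the variable does not occur in \<open>mon \<beta>\<close> and the
      derivative vanishes, or the lowered exponent differs from \<open>\<alpha>\<close> and the
      monomials are orthogonal.\<close>
    then have "\<beta> (i, l) = 0 \<or> \<alpha> \<noteq> \<beta> - ?u" using unit_exp_add_diff[of \<beta> "(i, l)"] by auto
    with False show ?thesis unfolding lhs rhs by auto
  qed
qed

text \<open>Both sides are linear in \<open>p\<close> and conjugate-linear in \<open>q\<close>, so
  the identity for monomials suffices.\<close>

lemma fischer_var:
  assumes "p \<in> polys" "q \<in> polys"
  shows "fischer (var (i, l) * p) q = fischer p (partial i l q)"
proof -
  have mon_left: "fischer (var (i, l) * mon \<alpha>) q = fischer (mon \<alpha>) (partial i l q)" for \<alpha>
    using assms(2)
  proof (induction rule: polys_induct)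
    case zero
    show ?case by (simp only: partial_zero fischer_zero_right)
  next
    case (step c \<beta> q)
    then show ?case
      by (simp only: partial_add partial_scale polys_scale mon_in_polys fischer_add_right
          fischer_scale_right partial_in_polys fischer_var_mon)
  qed
  show ?thesis
    using assms(1)
  proof (induction rule: polys_induct)
    case zero
    show ?case by (simp only: mult_zero_right fischer_zero_left)
  next
    case (step c \<alpha> p)
    have "var (i, l) * ((\<lambda>x. c * mon \<alpha> x) + p) = (\<lambda>x. c * (var (i, l) * mon \<alpha>) x) + var (i, l) * p"
      by (simp add: fun_eq_iff algebra_simps)
    with step show ?case
      by (simp only: polys_scale polys_mult mon_in_polys var_in_polys fischer_add_left
          fischer_scale_left mon_left)
  qed
qed

lemma rsq_eq: "rsq i j = (\<Sum>l\<in>UNIV. var (i, l) * var (j, l))"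
  by (simp add: fun_eq_iff rsq_def sum_fun_apply var_def)

lemma mixed_laplacian_eq: "mixed_laplacian i j p = (\<Sum>l\<in>UNIV. partial i l (partial j l p))"
  by (simp add: fun_eq_iff mixed_laplacian_def sum_fun_apply)

lemma rsq_in_polys [simp]: "rsq i j \<in> polys"
  by (simp add: rsq_eq polys_sum polys_mult)

lemma fischer_rsq:
  assumes "p \<in> polys" "q \<in> polys"
  shows "fischer (rsq i j * p) q = fischer p (mixed_laplacian i j q)"
proof -
  \<comment> \<open>The factor \<open>var (j, l)\<close> is put outermost because adjoints are taken
    from the outside in, which yields the derivatives in the order used by
    \<open>mixed_laplacian\<close>.\<close>
  have "rsq i j * p = (\<Sum>l\<in>UNIV. var (j, l) * (var (i, l) * p))"
    by (simp add: rsq_eq sum_distrib_left sum_distrib_right mult_ac)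
  then have "fischer (rsq i j * p) q = (\<Sum>l\<in>UNIV. fischer (var (j, l) * (var (i, l) * p)) q)"
    using assms by (simp only: fischer_sum_left polys_mult var_in_polys)
  also have "\<dots> = (\<Sum>l\<in>UNIV. fischer p (partial i l (partial j l q)))"
    using assms by (simp only: fischer_var polys_mult var_in_polys partial_in_polys)
  finally show ?thesis
    using assms by (simp only: fischer_sum_right mixed_laplacian_eq partial_in_polys)
qed

section \<open>Orthogonal projection\<close>

lemma fischer_orthogonal_span:
  assumes "S \<subseteq> polys" "\<And>s. s \<in> S \<Longrightarrow> fischer p s = 0" "y \<in> cfun.span S"
  shows "fischer p y = 0"
proof -
  have "y \<in> polys \<and> fischer p y = 0"
    using assms(3)
  proof (induction rule: cfun.span_induct_alt)
    case base
    show ?case by (intro conjI polys_zero fischer_zero_right)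
  next
    case (step c a y)
    then have "a \<in> polys" "fischer p a = 0" using assms by auto
    with step show ?case
      by (simp only: fischer_add_right fischer_scale_right polys_scale polys_add) simp
  qed
  then show ?thesis ..
qed

text \<open>Gram-Schmidt: project both \<open>p\<close> and the new vector \<open>a\<close> onto the
  span of \<open>S\<close>, then correct \<open>p\<close> along the component \<open>b\<close> of
  \<open>a\<close> orthogonal to \<open>S\<close>. Orthogonality to \<open>b\<close> and to the
  projection \<open>z\<close> of \<open>a\<close> gives orthogonality to \<open>a\<close>.\<close>

lemma fischer_projection:
  assumes "finite S" "S \<subseteq> polys" "p \<in> polys"
  shows "\<exists>y\<in>cfun.span S. \<forall>s\<in>S. fischer (p - y) s = 0"
  using assms
proof (induction S arbitrary: p rule: finite_induct)
  case empty
  then show ?case using cfun.span_zero by blast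
next
  case (insert a S)
  have span_polys: "cfun.span S \<subseteq> polys"
    using insert.prems(1) cfun.span_minimal[OF _ subspace_polys] by blast
  obtain y where y: "y \<in> cfun.span S" "\<And>s. s \<in> S \<Longrightarrow> fischer (p - y) s = 0"
    using insert.IH[of p] insert.prems by blast
  obtain z where z: "z \<in> cfun.span S" "\<And>s. s \<in> S \<Longrightarrow> fischer (a - z) s = 0"
    using insert.IH[of a] insert.prems by blast
  define b where "b = a - z"
  define c where "c = - (fischer (p - y) b / fischer b b)"
  define r where "r = (\<lambda>x. c * b x) + (p - y)"
  have polys: "b \<in> polys" "p - y \<in> polys" "z \<in> polys"
    using y z span_polys insert.prems by (auto simp: b_def intro!: polys_diff)
  have rS: "fischer r s = 0" if "s \<in> S" for s
    using y(2)[OF that] z(2)[OF that] polys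
    by (simp add: r_def fischer_add_left fischer_scale_left polys_scale b_def[symmetric])
  have "fischer r b = c * fischer b b + fischer (p - y) b"
    using polys by (simp only: r_def fischer_add_left fischer_scale_left polys_scale)
  then have "fischer r b = 0"
  proof (cases "fischer b b = 0")
    case True
    then have "b = 0" using polys fischer_definite by blast
    then show ?thesis by simp
  next
    case False
    then show ?thesis using \<open>fischer r b = _\<close> by (simp add: c_def)
  qed
  moreover have "fischer r z = 0"
    using fischer_orthogonal_span[OF _ rS z(1)] insert.prems(1) by blast
  moreover have "a = b + z" by (simp add: b_def)
  ultimately have ra: "fischer r a = 0" using polys by (simp only: fischer_add_right) simp
  let ?y = "y - (\<lambda>x. c * b x)"
  have "p - ?y = r" by (simp add: r_def)
  moreover have "?y \<in> cfun.span (insert a S)"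
  proof -
    have sub: "cfun.span S \<subseteq> cfun.span (insert a S)" by (rule cfun.span_mono) auto
    have "b \<in> cfun.span (insert a S)"
      unfolding b_def by (rule cfun.span_diff[OF cfun.span_base[OF insertI1] subsetD[OF sub z(1)]])
    from cfun.span_diff[OF subsetD[OF sub y(1)] cfun.span_scale[OF this]] show ?thesis .
  qed
  moreover have "\<forall>s\<in>insert a S. fischer r s = 0" using rS ra by blast
  ultimately show ?case by (intro bexI[of _ ?y]) (simp only:)
qed

section \<open>Harmonics and the ideal generated by the \<open>rsq i j\<close>\<close>

lemma harmonics_subset: "harmonics \<subseteq> polys"
  by (auto simp: harmonics_def)

lemma harmonics_iff: "h \<in> harmonics \<longleftrightarrow> h \<in> polys \<and> (\<forall>i j. i \<le> j \<longrightarrow> mixed_laplacian i j h = 0)"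
  by (auto simp: harmonics_def fun_eq_iff)

text \<open>The generators already contain arbitrary polynomial factors, so their linear span is an
  ideal.\<close>

definition rsq_ideal :: "(real ^ 'm ^ 'k::{finite,linorder} \<Rightarrow> complex) set"
  where "rsq_ideal = cfun.span {rsq i j * p | i j p. i \<le> j \<and> p \<in> polys}"

text \<open>Adjointness moves \<open>rsq i j\<close> onto \<open>h\<close> as a Laplacian, so
  \<open>h\<close> is orthogonal to every generator and hence to itself.\<close>

lemma harmonic_in_ideal:
  fixes h :: "real ^ 'm ^ 'k::{finite,linorder} \<Rightarrow> complex"
  assumes h: "h \<in> harmonics" and "h \<in> rsq_ideal"
  shows "h = 0"
proof -
  have hp: "h \<in> polys" using h harmonics_subset by blast
  let ?G = "{rsq i j * p | i j (p :: real ^ 'm ^ 'k::{finite,linorder} \<Rightarrow> complex). i \<le> j \<and> p \<in> polys}"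
  have "fischer h h = 0"
  proof (rule fischer_orthogonal_span)
    show "h \<in> cfun.span ?G"
      using assms(2) by (simp add: rsq_ideal_def)
    show "?G \<subseteq> polys" by (auto simp: polys_mult)
    fix s assume "s \<in> ?G"
    then obtain i j p where s: "s = rsq i j * p" "i \<le> j" "p \<in> polys" by blast
    then have "fischer s h = fischer p (mixed_laplacian i j h)" using hp by (simp add: fischer_rsq)
    also have "\<dots> = 0" using h s by (simp add: harmonics_iff)
    finally show "fischer h s = 0" by (simp add: fischer_commute[of h s])
  qed
  then show ?thesis using hp fischer_definite by blast
qed

text \<open>Only finitely many products satisfy \<open>deg \<alpha> + 2 \<le> d\<close>, so
  \<open>p\<close> can be projected onto their span. This bound keeps the products within degree
  \<open>d\<close> and lets the existence proof recurse on smaller degrees.\<close>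

lemma harmonic_decomposition:
  fixes p :: "real ^ 'm ^ 'k::{finite,linorder} \<Rightarrow> complex"
  assumes p: "p \<in> cfun.span (mon ` {\<alpha>. deg \<alpha> \<le> d})"
  obtains h y where "h \<in> harmonics" "p = h + y"
    "y \<in> cfun.span {rsq i j * mon \<alpha> | i j \<alpha>. i \<le> j \<and> deg \<alpha> + 2 \<le> d}"
proof -
  let ?P = "\<lambda>n. cfun.span (mon ` {\<alpha> :: 'k \<times> 'm \<Rightarrow> nat. deg \<alpha> + n \<le> d})"
  define S where "S = {rsq i j * mon \<alpha> | (i :: 'k) j (\<alpha> :: 'k \<times> 'm \<Rightarrow> nat). i \<le> j \<and> deg \<alpha> + 2 \<le> d}"
  have P_polys: "?P n \<subseteq> polys" for n
    unfolding polys_eq_span by (intro cfun.span_mono) auto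
  have "S \<subseteq> (\<lambda>(i, j, \<alpha>). rsq i j * mon \<alpha>) ` (UNIV \<times> UNIV \<times> {\<alpha>. deg \<alpha> \<le> d})"
    unfolding S_def by force
  then have "finite S"
    by (rule finite_subset) (intro finite_imageI finite_cartesian_product finite_deg_le finite)
  moreover have S_polys: "S \<subseteq> polys" unfolding S_def by (auto simp: polys_mult)
  moreover have "p \<in> polys" using P_polys[of 0] p by auto
  ultimately obtain y where y: "y \<in> cfun.span S" "\<And>s. s \<in> S \<Longrightarrow> fischer (p - y) s = 0"
    using fischer_projection[of S p] by blast
  have y_polys: "y \<in> polys" using y S_polys cfun.span_minimal[OF _ subspace_polys] by blast
  have "S \<subseteq> ?P 0"
  proof
    fix s assume "s \<in> S"
    then obtain i j \<alpha> where s: "s = rsq i j * mon \<alpha>" "deg \<alpha> + 2 \<le> d"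
      unfolding S_def by blast
    have "s = (\<Sum>l\<in>UNIV. mon (unit_exp (i, l) + unit_exp (j, l) + \<alpha>))"
      by (simp add: s rsq_eq mon_add mon_unit_exp sum_distrib_right)
    moreover have "mon (unit_exp (i, l) + unit_exp (j, l) + \<alpha>) \<in> ?P 0" for l
      using s(2) by (intro cfun.span_base[OF imageI[of "unit_exp (i, l) + unit_exp (j, l) + \<alpha>"]])
        (simp add: deg_add)
    ultimately show "s \<in> ?P 0" by (simp only: cfun.span_sum)
  qed
  then have "y \<in> ?P 0" using y(1) cfun.span_minimal[OF _ cfun.subspace_span] by blast
  then have h: "p - y \<in> ?P 0" using p by (intro cfun.span_diff) simp_all
  have "mixed_laplacian i j (p - y) = 0" if "i \<le> j" for i j
  proof -
    let ?L = "mixed_laplacian i j (p - y)"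
    have L: "?L \<in> ?P 2"
      unfolding mixed_laplacian_eq numeral_2_eq_2
      by (intro cfun.span_sum partial_span_deg h)
    then have L_polys: "?L \<in> polys" using P_polys[of 2] by blast
    \<comment> \<open>\<open>?L\<close> lies in \<open>?P 2\<close>, so \<open>rsq i j * ?L\<close>
      belongs to the space to which \<open>p - y\<close> is orthogonal; adjointness turns this into
      \<open>fischer ?L ?L = 0\<close>.\<close>
    have "rsq i j * ?L \<in> cfun.span S"
      using L
    proof (induction rule: cfun.span_induct_alt)
      case base
      show ?case using cfun.span_zero by (simp only: mult_zero_right)
    next
      case (step c a q)
      then have "rsq i j * a \<in> cfun.span S" unfolding S_def using that by (intro cfun.span_base) auto
      moreover have "rsq i j * ((\<lambda>x. c * a x) + q) = (\<lambda>x. c * (rsq i j * a) x) + rsq i j * q"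
        by (simp add: fun_eq_iff algebra_simps)
      ultimately show ?case using step.IH by (simp only: cfun.span_add cfun.span_scale)
    qed
    then have "fischer (p - y) (rsq i j * ?L) = 0"
      using fischer_orthogonal_span[OF S_polys y(2)] by blast
    then have "fischer (rsq i j * ?L) (p - y) = 0" by (simp add: fischer_commute[of "rsq i j * ?L"])
    then have "fischer ?L ?L = 0"
      by (simp only: fischer_rsq[OF L_polys polys_diff[OF \<open>p \<in> polys\<close> y_polys]])
    then show ?thesis using fischer_definite L_polys by blast
  qed
  then have "p - y \<in> harmonics"
    using \<open>p \<in> polys\<close> y_polys by (simp add: harmonics_iff polys_diff)
  then show ?thesis using that[of "p - y" y] y(1) by (simp add: S_def)
qed

section \<open>Coprime leading monomials\<close>

lemma finite_index_pairs [simp]: "finite (index_pairs :: ('k::{finite,linorder} \<times> 'k) set)"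
  by (rule finite)

lemma rsq_monomial_eq: "rsq_monomial n = (\<Prod>a\<in>index_pairs. rsq (fst a) (snd a) ^ n a)"
  by (simp add: fun_eq_iff rsq_monomial_def prod_fun_apply power_fun_apply case_prod_beta)

lemma rsq_monomial_cong: "(\<And>a. a \<in> index_pairs \<Longrightarrow> n a = n' a) \<Longrightarrow> rsq_monomial n = rsq_monomial n'"
  by (simp add: rsq_monomial_eq)

lemma rsq_monomial_add: "rsq_monomial (n + n') = rsq_monomial n * rsq_monomial n'"
  by (simp add: rsq_monomial_eq power_add prod.distrib)

lemma polys_prod_power:
  assumes "\<And>a. a \<in> A \<Longrightarrow> f a \<in> polys"
  shows "(\<Prod>a\<in>A. f a ^ n a) \<in> polys"
proof -
  have one: "1 \<in> polys" using mon_in_polys[of 0] by simp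
  have "f a ^ k \<in> polys" if "a \<in> A" for a k
    by (induction k) (simp_all only: power_0 power_Suc one assms[OF that] polys_mult)
  then show ?thesis
    by (induction A rule: infinite_finite_induct)
      (simp_all only: one polys_mult insertI1 insertI2 prod.infinite prod.empty prod.insert simp_thms)
qed

lemma rsq_monomial_in_polys [simp]: "rsq_monomial n \<in> polys"
  unfolding rsq_monomial_eq by (rule polys_prod_power) simp

lemma rsq_monomial_mult_in_ideal:
  fixes p :: "real ^ 'm ^ 'k::{finite,linorder} \<Rightarrow> complex"
  assumes "a \<in> index_pairs" "n a > 0" "p \<in> polys"
  shows "rsq_monomial n * p \<in> rsq_ideal"
proof -
  define n' where "n' = (\<lambda>b. n b - unit_exp a b)"
  have n: "n = unit_exp a + n'" using assms(2) by (auto simp: n'_def unit_exp_def fun_eq_iff)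
  have "(rsq_monomial (unit_exp a) :: real ^ 'm ^ 'k::{finite,linorder} \<Rightarrow> complex) = (\<Prod>b\<in>index_pairs. if b = a then rsq (fst b) (snd b) else 1)"
    unfolding rsq_monomial_eq by (rule prod.cong) (auto simp: unit_exp_def)
  then have "(rsq_monomial (unit_exp a) :: real ^ 'm ^ 'k::{finite,linorder} \<Rightarrow> complex) = rsq (fst a) (snd a)"
    using assms(1) by simp
  then have "rsq_monomial n * p = rsq (fst a) (snd a) * (rsq_monomial n' * p)"
    by (simp add: n rsq_monomial_add mult.assoc)
  moreover have "fst a \<le> snd a" using assms(1) by (auto simp: index_pairs_def)
  moreover have "rsq_monomial n' * p \<in> polys" using assms(3) by (simp only: polys_mult rsq_monomial_in_polys)
  ultimately show ?thesis
    unfolding rsq_ideal_def by (intro cfun.span_base) blast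
qed

section \<open>Weights and leading monomials\<close>

definition wt :: "('v \<Rightarrow> nat) \<Rightarrow> ('v \<Rightarrow> nat) \<Rightarrow> nat"
  where "wt w \<alpha> = (\<Sum>v\<in>UNIV. w v * \<alpha> v)"

lemma wt_add: "wt w (\<alpha> + \<beta>) = wt w \<alpha> + wt w \<beta>"
  by (simp add: wt_def sum.distrib algebra_simps)

lemma wt_unit_exp [simp]: "wt w (unit_exp (v :: 'v::finite)) = w v"
proof -
  have "wt w (unit_exp v) = (\<Sum>u\<in>UNIV. if u = v then w u else 0)"
    unfolding wt_def unit_exp_def by (rule sum.cong) auto
  then show ?thesis by simp
qed

text \<open>The leading coefficient is normalised to 1, and all other monomials have strictly
  smaller weight; ties in weight with the leading monomial are excluded.\<close>

definition leads :: "('k \<times> 'm \<Rightarrow> nat) \<Rightarrow> (real ^ 'm ^ 'k \<Rightarrow> complex) \<Rightarrow> ('k \<times> 'm \<Rightarrow> nat) \<Rightarrow> bool"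
  where "leads w f \<alpha> \<longleftrightarrow> f - mon \<alpha> \<in> cfun.span (mon ` {\<beta>. wt w \<beta> < wt w \<alpha>})"

lemma leads_mon: "leads w (mon \<alpha>) \<alpha>"
  using cfun.span_zero by (simp add: leads_def)

text \<open>Splitting each factor into leading monomial and lower part,
  \<open>f * g - mon (\<alpha> + \<beta>)\<close> is a sum of three products, each with at least one
  lower factor.\<close>

lemma leads_mult:
  assumes f: "leads w f \<alpha>" and g: "leads w g \<beta>"
  shows "leads w (f * g) (\<alpha> + \<beta>)"
proof -
  let ?U = "{\<gamma>. wt w \<gamma> < wt w (\<alpha> + \<beta>)}"
  have "(f - mon \<alpha>) * (g - mon \<beta>) \<in> cfun.span (mon ` ?U)"
    by (rule span_mon_mult[OF _ f[unfolded leads_def] g[unfolded leads_def]]) (auto simp: wt_add)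
  moreover have "(f - mon \<alpha>) * mon \<beta> \<in> cfun.span (mon ` ?U)"
    by (rule span_mon_mult[OF _ f[unfolded leads_def], of "{\<beta>}"]) (auto simp: wt_add cfun.span_base)
  moreover have "mon \<alpha> * (g - mon \<beta>) \<in> cfun.span (mon ` ?U)"
    by (rule span_mon_mult[OF _ _ g[unfolded leads_def], of "{\<alpha>}"]) (auto simp: wt_add cfun.span_base)
  ultimately have "(f - mon \<alpha>) * (g - mon \<beta>) + (f - mon \<alpha>) * mon \<beta> + mon \<alpha> * (g - mon \<beta>)
      \<in> cfun.span (mon ` ?U)"
    by (intro cfun.span_add)
  moreover have "(f - mon \<alpha>) * (g - mon \<beta>) + (f - mon \<alpha>) * mon \<beta> + mon \<alpha> * (g - mon \<beta>)
      = f * g - mon (\<alpha> + \<beta>)"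
    by (simp add: mon_add fun_eq_iff algebra_simps)
  ultimately show ?thesis by (simp only: leads_def)
qed

lemma leads_prod_power:
  assumes "finite A" "\<And>a. a \<in> A \<Longrightarrow> leads w (f a) (\<alpha> a)"
  shows "leads w (\<Prod>a\<in>A. f a ^ n a) (\<lambda>v. \<Sum>a\<in>A. n a * \<alpha> a v)"
proof -
  have one: "leads w 1 0" using leads_mon[of w 0] by simp
  have pow: "leads w (f a ^ k) (\<lambda>v. k * \<alpha> a v)" if "a \<in> A" for a k
  proof (induction k)
    case 0
    show ?case using one by (simp only: power_0 mult_0 zero_fun_def)
  next
    case (Suc k)
    from leads_mult[OF assms(2)[OF that] this] show ?case by (simp only: power_Suc mult_Suc plus_fun_def)
  qed
  show ?thesis
    using assms(1) pow
  proof (induction A rule: finite_induct)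
    case empty
    show ?case using one by (simp only: prod.empty sum.empty zero_fun_def)
  next
    case (insert a A)
    from leads_mult[OF insert.prems[of a "n a"] insert.IH] insert.prems insert.hyps
    show ?case by (simp add: plus_fun_def times_fun_def)
  qed
qed

text \<open>\<open>\<mu> a\<close> is the exponent of the leading monomial of the \<open>rsq\<close>
  of the pair \<open>a\<close>; disjoint supports express that these monomials are pairwise coprime.
  The uniqueness argument sees the weights only through these assumptions.\<close>

locale coprime_leading_exponents =
  fixes w :: "'k::{finite,linorder} \<times> 'm::finite \<Rightarrow> nat"
    and \<mu> :: "'k \<times> 'k \<Rightarrow> 'k \<times> 'm \<Rightarrow> nat"
  assumes leads_rsq: "a \<in> index_pairs \<Longrightarrow> leads w (rsq (fst a) (snd a)) (\<mu> a)"
    and \<mu>_nonzero: "a \<in> index_pairs \<Longrightarrow> \<exists>v. \<mu> a v > 0"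
    and \<mu>_disjoint: "a \<in> index_pairs \<Longrightarrow> b \<in> index_pairs \<Longrightarrow> \<mu> a v > 0 \<Longrightarrow> \<mu> b v > 0 \<Longrightarrow> a = b"
begin

section \<open>Basis adapted to the leading monomials\<close>

definition lead :: "('k \<times> 'k \<Rightarrow> nat) \<Rightarrow> 'k \<times> 'm \<Rightarrow> nat"
  where "lead n = (\<lambda>v. \<Sum>a\<in>index_pairs. n a * \<mu> a v)"

text \<open>The largest power of \<open>mon (\<mu> a)\<close> dividing \<open>mon \<alpha>\<close>;
  for \<open>a\<close> in \<open>index_pairs\<close> the minimum is over a non-empty set by
  \<open>\<mu>_nonzero\<close>.\<close>

definition quot :: "('k \<times> 'm \<Rightarrow> nat) \<Rightarrow> 'k \<times> 'k \<Rightarrow> nat"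
  where "quot \<alpha> a = Min ((\<lambda>v. \<alpha> v div \<mu> a v) ` {v. \<mu> a v > 0})"

text \<open>Each leading monomial is replaced by its \<open>rsq\<close> as often as it divides
  \<open>mon \<alpha>\<close>. The subtraction in the cofactor is exact by
  \<open>lead_quot_le\<close>.\<close>

definition adapted :: "('k \<times> 'm \<Rightarrow> nat) \<Rightarrow> real ^ 'm ^ 'k::{finite,linorder} \<Rightarrow> complex"
  where "adapted \<alpha> = rsq_monomial (quot \<alpha>) * mon (\<alpha> - lead (quot \<alpha>))"

lemma leads_rsq_monomial: "leads w (rsq_monomial n) (lead n)"
  unfolding rsq_monomial_eq lead_def by (rule leads_prod_power) (simp_all add: leads_rsq)

lemma lead_add: "lead (n + n') = lead n + lead n'"
  by (simp add: lead_def fun_eq_iff algebra_simps sum.distrib)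

lemma lead_cong: "(\<And>a. a \<in> index_pairs \<Longrightarrow> n a = n' a) \<Longrightarrow> lead n = lead n'"
  by (simp add: lead_def)

lemma lead_at:
  assumes "a \<in> index_pairs" "\<mu> a v > 0"
  shows "lead n v = n a * \<mu> a v"
proof -
  have "lead n v = (\<Sum>b\<in>index_pairs. if b = a then n a * \<mu> a v else 0)"
    unfolding lead_def by (rule sum.cong) (use \<mu>_disjoint[OF assms(1) _ assms(2)] in auto)
  then show ?thesis using assms(1) by simp
qed

text \<open>By disjointness at most one pair contributes at \<open>v\<close>, so the maximal powers
  of all leading monomials can be divided out simultaneously.\<close>

lemma lead_quot_le: "lead (quot \<alpha>) v \<le> \<alpha> v"
proof (cases "\<exists>a\<in>index_pairs. \<mu> a v > 0")
  case True
  then obtain a where a: "a \<in> index_pairs" "\<mu> a v > 0" by blast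
  have "quot \<alpha> a \<le> \<alpha> v div \<mu> a v" unfolding quot_def using a by (intro Min_le) auto
  then have "quot \<alpha> a * \<mu> a v \<le> \<alpha> v div \<mu> a v * \<mu> a v" by (rule mult_le_mono1)
  also have "\<dots> \<le> \<alpha> v" by simp
  finally show ?thesis using lead_at[OF a] by simp
next
  case False
  then show ?thesis by (simp add: lead_def)
qed

text \<open>On the support of \<open>\<mu> a\<close>, \<open>lead n\<close> adds the exact multiple
  \<open>n a * \<mu> a v\<close>, so every quotient, and with it the minimum, grows by
  \<open>n a\<close>.\<close>

lemma quot_add_lead:
  assumes "a \<in> index_pairs"
  shows "quot (\<alpha> + lead n) a = quot \<alpha> a + n a"
proof -
  let ?V = "{v. \<mu> a v > 0}"
  have "(\<lambda>v. (\<alpha> + lead n) v div \<mu> a v) ` ?V = (\<lambda>v. \<alpha> v div \<mu> a v + n a) ` ?V"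
    by (rule image_cong) (auto simp: lead_at[OF assms])
  then show ?thesis
    unfolding quot_def using \<mu>_nonzero[OF assms]
    by (simp only:) (rule Min_add_commute, auto)
qed

lemma leads_adapted: "leads w (adapted \<alpha>) \<alpha>"
proof -
  have "lead (quot \<alpha>) + (\<alpha> - lead (quot \<alpha>)) = \<alpha>"
    using lead_quot_le by (simp add: fun_eq_iff)
  then show ?thesis
    unfolding adapted_def using leads_mult[OF leads_rsq_monomial leads_mon] by metis
qed

text \<open>Adding \<open>lead n\<close> raises the \<open>rsq\<close> part by \<open>n\<close> and
  leaves the cofactor unchanged. Hence multiplication by \<open>rsq_monomial n\<close> maps the
  basis into itself by a shift of the index.\<close>

lemma adapted_shift: "adapted (\<alpha> + lead n) = rsq_monomial n * adapted \<alpha>"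
proof -
  have "(rsq_monomial (quot (\<alpha> + lead n)) :: real ^ 'm ^ 'k::{finite,linorder} \<Rightarrow> complex) = rsq_monomial n * rsq_monomial (quot \<alpha>)"
    unfolding rsq_monomial_add[symmetric] by (rule rsq_monomial_cong) (simp add: quot_add_lead)
  moreover have "lead (quot (\<alpha> + lead n)) = lead (quot \<alpha>) + lead n"
    unfolding lead_add[symmetric] by (rule lead_cong) (simp add: quot_add_lead)
  moreover have "\<alpha> + lead n - (lead (quot \<alpha>) + lead n) = \<alpha> - lead (quot \<alpha>)"
    by (simp add: fun_eq_iff)
  ultimately show ?thesis by (simp only: adapted_def mult.assoc)
qed

lemma adapted_triangular: "adapted \<alpha> - mon \<alpha> \<in> cfun.span (mon ` {\<beta>. wt w \<beta> < wt w \<alpha>})"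
  using leads_adapted by (simp add: leads_def)

interpretation adapted: indep_family "\<lambda>(c::complex) (f :: real ^ 'm ^ 'k::{finite,linorder} \<Rightarrow> complex) x. c * f x" adapted
  using adapted_triangular by (rule mon.triangular_indep)

lemma span_adapted: "cfun.span (range adapted) = polys"
proof (rule equalityI)
  show "cfun.span (range adapted) \<subseteq> polys"
    unfolding polys_eq_span
    using mon.triangular_in_span[OF adapted_triangular] by (intro cfun.span_minimal) auto
  show "polys \<subseteq> cfun.span (range adapted)"
    unfolding polys_eq_span
    using mon.triangular_spans[OF adapted_triangular] by (intro cfun.span_minimal) auto
qed

text \<open>The shift of the index by \<open>lead n\<close> is injective, so multiplication by
  \<open>rsq_monomial n\<close> only moves coordinates and creates none outside the image of the
  shift.\<close>

lemma coord_shift: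
  assumes "p \<in> polys"
  shows "adapted.coord (\<beta> + lead n) (rsq_monomial n * p) = adapted.coord \<beta> p"
    and "(\<And>\<alpha>. \<alpha> + lead n \<noteq> \<gamma>) \<Longrightarrow> adapted.coord \<gamma> (rsq_monomial n * p) = 0"
proof -
  have distrib: "rsq_monomial n * ((\<lambda>x. c * a x) + q) = (\<lambda>x. c * (rsq_monomial n * a) x) + rsq_monomial n * q"
    for c a and q :: "real ^ 'm ^ 'k::{finite,linorder} \<Rightarrow> complex"
    by (simp add: fun_eq_iff algebra_simps)
  have lin: "adapted.coord \<gamma> ((\<lambda>x. c * a x) + q) = c * adapted.coord \<gamma> a + adapted.coord \<gamma> q"
    if "a \<in> polys" "q \<in> polys" for \<gamma> c a q
    using that by (simp only: adapted.coord_add adapted.coord_scale span_adapted polys_scale)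
  have adapted_polys: "adapted \<alpha> \<in> polys" for \<alpha>
    using cfun.span_base[OF rangeI, of adapted \<alpha>] by (simp only: span_adapted)
  have *: "p \<in> polys \<and> adapted.coord (\<beta> + lead n) (rsq_monomial n * p) = adapted.coord \<beta> p \<and>
      ((\<forall>\<alpha>. \<alpha> + lead n \<noteq> \<gamma>) \<longrightarrow> adapted.coord \<gamma> (rsq_monomial n * p) = 0)"
    if "p \<in> cfun.span (range adapted)"
    using that
  proof (induction rule: cfun.span_induct_alt)
    case base
    show ?case by (simp only: mult_zero_right adapted.coord_zero polys_zero simp_thms)
  next
    case (step c a q)
    then obtain \<alpha> where a: "a = adapted \<alpha>" by blast
    have "adapted.coord (\<beta> + lead n) (rsq_monomial n * a) = adapted.coord \<beta> a"
      by (simp add: a adapted_shift[symmetric] adapted.coord_family)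
    moreover have "(\<forall>\<alpha>. \<alpha> + lead n \<noteq> \<gamma>) \<longrightarrow> adapted.coord \<gamma> (rsq_monomial n * a) = 0"
      by (auto simp: a adapted_shift[symmetric] adapted.coord_family)
    moreover have "a \<in> polys" "rsq_monomial n * a \<in> polys" "rsq_monomial n * q \<in> polys"
      using adapted_polys[of \<alpha>] step.IH by (simp_all only: a polys_mult rsq_monomial_in_polys)
    ultimately show ?case
      using step.IH by (simp only: distrib lin polys_add polys_scale) (simp add: plus_fun_def times_fun_def)
  qed
  show "adapted.coord (\<beta> + lead n) (rsq_monomial n * p) = adapted.coord \<beta> p"
    using * assms by (simp add: span_adapted)
  show "adapted.coord \<gamma> (rsq_monomial n * p) = 0" if "\<And>\<alpha>. \<alpha> + lead n \<noteq> \<gamma>"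
    using * assms that by (simp add: span_adapted)
qed

section \<open>Uniqueness of harmonic expansions\<close>

lemma in_ideal:
  assumes p: "p \<in> polys"
    and 0: "\<And>\<beta>. (\<forall>a\<in>index_pairs. quot \<beta> a = 0) \<Longrightarrow> adapted.coord \<beta> p = 0"
  shows "p \<in> rsq_ideal"
proof -
  \<comment> \<open>A basis element with non-zero coordinate has \<open>quot \<alpha> a > 0\<close>
    for some pair, hence contains a factor from the ideal.\<close>
  have "(\<lambda>x. adapted.coord \<alpha> p * adapted \<alpha> x) \<in> rsq_ideal" if \<alpha>: "adapted.coord \<alpha> p \<noteq> 0" for \<alpha>
  proof -
    from 0[of \<alpha>] \<alpha> obtain a where "a \<in> index_pairs" "quot \<alpha> a > 0" by blast
    from rsq_monomial_mult_in_ideal[of a "quot \<alpha>", OF this mon_in_polys] show ?thesis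
      unfolding rsq_ideal_def adapted_def by (rule cfun.span_scale)
  qed
  then have "(\<Sum>\<alpha> | adapted.coord \<alpha> p \<noteq> 0. (\<lambda>x. adapted.coord \<alpha> p * adapted \<alpha> x)) \<in> rsq_ideal"
    unfolding rsq_ideal_def by (intro cfun.span_sum) simp
  then show ?thesis using adapted.sum_coord[of p] p by (simp only: span_adapted)
qed

text \<open>For a non-zero \<open>h N\<close> with \<open>N\<close> of least total exponent, the
  coordinates at \<open>\<beta> + lead N\<close>, with \<open>\<beta>\<close> divisible by no
  leading monomial, come from \<open>h N\<close> alone. Their vanishing puts \<open>h N\<close> in
  the ideal, where 0 is the only harmonic.\<close>

lemma harmonic_expansion_unique:
  fixes h :: "('k \<times> 'k \<Rightarrow> nat) \<Rightarrow> real ^ 'm ^ 'k::{finite,linorder} \<Rightarrow> complex"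
  assumes F: "finite F" "F \<subseteq> exponent_families"
    and h: "\<And>n. n \<in> F \<Longrightarrow> h n \<in> harmonics"
    and sum: "(\<Sum>n\<in>F. rsq_monomial n * h n) = 0"
  shows "\<forall>n\<in>F. h n = 0"
proof (rule ccontr)
  let ?B = "{n \<in> F. h n \<noteq> 0}"
  let ?size = "\<lambda>n. \<Sum>a\<in>index_pairs. n a"
  assume "\<not> (\<forall>n\<in>F. h n = 0)"
  then obtain N where N: "N \<in> ?B" "\<And>n. n \<in> ?B \<Longrightarrow> ?size N \<le> ?size n"
    using ex_has_least_nat[of "\<lambda>n. n \<in> ?B" _ ?size] by blast
  have h_polys: "h n \<in> polys" if "n \<in> F" for n using h[OF that] harmonics_subset by blast
  have "h N \<in> rsq_ideal"
  proof (rule in_ideal)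
    show "h N \<in> polys" using h_polys N by blast
    fix \<beta> assume \<beta>: "\<forall>a\<in>index_pairs. quot \<beta> a = 0"
    have other: "adapted.coord (\<beta> + lead N) (rsq_monomial n * h n) = 0" if n: "n \<in> ?B" "n \<noteq> N" for n
    proof (rule coord_shift(2))
      show "h n \<in> polys" using h_polys n by blast
      fix \<alpha>
      show "\<alpha> + lead n \<noteq> \<beta> + lead N"
      proof
        assume eq: "\<alpha> + lead n = \<beta> + lead N"
        \<comment> \<open>Comparing \<open>quot\<close> of both sides gives
          \<open>quot \<alpha> a + n a = N a\<close>, so \<open>n\<close> lies below
          \<open>N\<close> entrywise; minimality of \<open>N\<close> then forces equality.\<close>
        have le: "n a \<le> N a" if "a \<in> index_pairs" for a
          using quot_add_lead[OF that, of \<alpha> n] quot_add_lead[OF that, of \<beta> N] \<beta> that eq by simp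
        have "n a = N a" if "a \<in> index_pairs" for a
        proof (rule ccontr)
          assume "n a \<noteq> N a"
          with le[OF that] have "n a < N a" by simp
          then have "?size n < ?size N" using le that by (intro sum_strict_mono_ex1) auto
          with N(2)[OF n(1)] show False by simp
        qed
        moreover have "n \<in> exponent_families" "N \<in> exponent_families" using n N F by auto
        ultimately have "n = N" unfolding exponent_families_def by (intro PiE_ext)
        with n show False by simp
      qed
    qed
    have "(\<Sum>n\<in>?B. rsq_monomial n * h n) = (\<Sum>n\<in>F. rsq_monomial n * h n)"
      by (rule sum.mono_neutral_left) (use F in auto)
    then have "0 = adapted.coord (\<beta> + lead N) (\<Sum>n\<in>?B. rsq_monomial n * h n)"
      by (simp only: sum adapted.coord_zero)
    also have "\<dots> = (\<Sum>n\<in>?B. adapted.coord (\<beta> + lead N) (rsq_monomial n * h n))"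
      by (rule adapted.coord_sum) (auto simp: span_adapted polys_mult h_polys)
    also have "\<dots> = (\<Sum>n\<in>?B. if n = N then adapted.coord \<beta> (h N) else 0)"
      by (rule sum.cong) (auto simp: other coord_shift(1) h_polys)
    also have "\<dots> = adapted.coord \<beta> (h N)" using N F by simp
    finally show "adapted.coord \<beta> (h N) = 0" by simp
  qed
  then have "h N = 0" using harmonic_in_ideal h N by blast
  with N show False by simp
qed

end

section \<open>The direct sum\<close>

lemma ex_coprime_leading_exponents:
  assumes "CARD('m) \<ge> 2 * CARD('k::{finite,linorder}) - 1"
  shows "\<exists>w (\<mu> :: 'k \<times> 'k \<Rightarrow> 'k \<times> 'm::finite \<Rightarrow> nat). coprime_leading_exponents w \<mu>"
proof -
  \<comment> \<open>Ranks and positions count from 0, so the peak of a pair is at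
    \<open>rk i + rk j\<close> with no shift by one. \<open>rk\<close> is an arbitrary bijection;
    the order on \<open>'k\<close> enters only through \<open>index_pairs\<close>.\<close>
  obtain rk :: "'k \<Rightarrow> nat" where rk: "bij_betw rk UNIV {0..<CARD('k)}"
    using ex_bij_betw_finite_nat[OF finite] by blast
  obtain pos :: "'m \<Rightarrow> nat" where pos: "bij_betw pos UNIV {0..<CARD('m)}"
    using ex_bij_betw_finite_nat[OF finite] by blast
  have rk_less: "rk i < CARD('k)" for i using bij_betwE[OF rk] by simp
  have pos_less: "pos l < CARD('m)" for l using bij_betwE[OF pos] by simp
  have rk_inj: "rk i = rk j \<longleftrightarrow> i = j" for i j using bij_betw_imp_inj_on[OF rk] by (simp add: inj_eq)
  have pos_inj: "pos i = pos j \<longleftrightarrow> i = j" for i j using bij_betw_imp_inj_on[OF pos] by (simp add: inj_eq)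
  define peak where "peak i j = inv pos (rk i + rk j)" for i j
  have pos_peak: "pos (peak i j) = rk i + rk j" for i j
  proof -
    \<comment> \<open>Each rank is at most \<open>CARD('k) - 1\<close>, so the sum is at most
      \<open>2 * CARD('k) - 2\<close>: this is where the dimension hypothesis makes room for the
      peak.\<close>
    have "rk i + rk j < CARD('m)" using assms rk_less[of i] rk_less[of j] by linarith
    then have "rk i + rk j \<in> range pos" using bij_betw_imp_surj_on[OF pos] by simp
    then show ?thesis unfolding peak_def by (rule f_inv_into_f)
  qed
  \<comment> \<open>\<open>C\<close> dominates every \<open>g v\<close>, so \<open>w\<close> is a
    natural number without truncation. It adds \<open>2 * C\<close> to the weight of every quadratic
    monomial and so leaves their comparison unchanged.\<close>
  define C :: int where "C = (int CARD('m) + 2 * int CARD('k))\<^sup>2"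
  define g where "g = (\<lambda>v. (int (pos (snd v)) - 2 * int (rk (fst v)))\<^sup>2)"
  define w where "w = (\<lambda>v. nat (C - g v))"
  have "g v \<le> C" for v
    unfolding g_def C_def
    using rk_less[of "fst v"] pos_less[of "snd v"] by (intro abs_le_square_iff[THEN iffD1]) linarith
  then have w: "int (w v) = C - g v" for v by (simp add: w_def)
  define \<mu> where "\<mu> = (\<lambda>a. unit_exp (fst a, peak (fst a) (snd a)) + unit_exp (snd a, peak (fst a) (snd a)))"
  have \<mu>_pos: "\<mu> a v > 0 \<longleftrightarrow> snd v = peak (fst a) (snd a) \<and> (fst v = fst a \<or> fst v = snd a)" for a v
    by (cases v) (auto simp: \<mu>_def unit_exp_def)
  have w_less: "w (i, l) + w (j, l) < w (i, peak i j) + w (j, peak i j)" if "l \<noteq> peak i j" for i j l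
  proof -
    \<comment> \<open>by \<open>(p - 2a)\<^sup>2 + (p - 2b)\<^sup>2 = 2 (p - (a + b))\<^sup>2 + 2 (a - b)\<^sup>2\<close>\<close>
    have g: "g (i, l') + g (j, l') =
        2 * (int (pos l') - int (rk i + rk j))\<^sup>2 + 2 * (int (rk i) - int (rk j))\<^sup>2" for l'
      by (simp add: g_def power2_eq_square algebra_simps)
    have "pos l \<noteq> rk i + rk j" using that pos_inj[of l "peak i j"] pos_peak[of i j] by simp
    then have "(int (pos l) - int (rk i + rk j))\<^sup>2 > 0" by simp
    then have "g (i, l) + g (j, l) > g (i, peak i j) + g (j, peak i j)"
      unfolding g by (simp add: pos_peak)
    then show ?thesis using w[of "(i, l)"] w[of "(j, l)"] w[of "(i, peak i j)"] w[of "(j, peak i j)"] by linarith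
  qed
  have "coprime_leading_exponents w \<mu>"
  proof
    fix a :: "'k \<times> 'k"
    obtain i j where a: "a = (i, j)" by (cases a)
    let ?f = "\<lambda>l. unit_exp (i, l) + unit_exp (j, l) :: 'k \<times> 'm \<Rightarrow> nat"
    have "(rsq i j :: real ^ 'm ^ 'k::{finite,linorder} \<Rightarrow> complex) = (\<Sum>l\<in>UNIV. mon (?f l))"
      by (simp add: rsq_eq mon_add mon_unit_exp)
    also have "\<dots> = mon (?f (peak i j)) + (\<Sum>l\<in>UNIV - {peak i j}. mon (?f l))"
      by (rule sum.remove) auto
    finally have "rsq i j - mon (\<mu> a) = (\<Sum>l\<in>UNIV - {peak i j}. mon (?f l))" by (simp add: \<mu>_def a)
    moreover have "mon (?f l) \<in> cfun.span (mon ` {\<beta>. wt w \<beta> < wt w (\<mu> a)})" if "l \<in> UNIV - {peak i j}" for l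
      using that by (intro cfun.span_base[OF imageI[of "?f l"]]) (simp add: \<mu>_def a wt_add w_less)
    ultimately show "leads w (rsq (fst a) (snd a)) (\<mu> a)" by (simp only: leads_def a fst_conv snd_conv cfun.span_sum)
    show "\<exists>v. \<mu> a v > 0" unfolding \<mu>_pos by auto
  next
    fix a b :: "'k \<times> 'k" and v :: "'k \<times> 'm"
    assume "a \<in> index_pairs" "b \<in> index_pairs" "\<mu> a v > 0" "\<mu> b v > 0"
    then have le: "fst a \<le> snd a" "fst b \<le> snd b"
      and v: "fst v = fst a \<or> fst v = snd a" "fst v = fst b \<or> fst v = snd b"
      and "pos (peak (fst a) (snd a)) = pos (peak (fst b) (snd b))"
      unfolding \<mu>_pos by (auto simp: index_pairs_def)
    then have "rk (fst a) + rk (snd a) = rk (fst b) + rk (snd b)" by (simp add: pos_peak)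
    \<comment> \<open>The two pairs share the index \<open>fst v\<close> and have equal rank sums,
      so they agree as unordered pairs; the condition \<open>i \<le> j\<close> makes them
      equal.\<close>
    with v have "(fst a = fst b \<and> snd a = snd b) \<or> (fst a = snd b \<and> snd a = fst b)"
      by (auto simp: rk_inj)
    with le show "a = b" by (auto simp: prod_eq_iff)
  qed
  then show ?thesis by blast
qed

section \<open>Subspaces and their finite sums\<close>

lemma mixed_laplacian_add:
  "p \<in> polys \<Longrightarrow> q \<in> polys \<Longrightarrow> mixed_laplacian i j (p + q) = mixed_laplacian i j p + mixed_laplacian i j q"
  by (simp only: mixed_laplacian_eq partial_add partial_in_polys sum.distrib)

lemma mixed_laplacian_scale:
  "p \<in> polys \<Longrightarrow> mixed_laplacian i j (\<lambda>x. c * p x) = (\<lambda>x. c * mixed_laplacian i j p x)"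
  by (simp only: mixed_laplacian_eq partial_scale partial_in_polys)
    (simp add: fun_eq_iff sum_fun_apply sum_distrib_left)

lemma subspace_harmonics: "cfun.subspace harmonics"
proof (rule cfun.subspaceI)
  show "0 \<in> harmonics"
    by (simp only: harmonics_iff mixed_laplacian_eq partial_zero polys_zero sum.neutral_const simp_thms)
  fix p q :: "real ^ 'm ^ 'k::{finite,linorder} \<Rightarrow> complex" and c
  assume p: "p \<in> harmonics"
  then show "(\<lambda>x. c * p x) \<in> harmonics"
    by (simp add: harmonics_iff polys_scale mixed_laplacian_scale) (simp add: zero_fun_def)
  assume "q \<in> harmonics"
  with p show "p + q \<in> harmonics"
    by (simp add: harmonics_iff polys_add mixed_laplacian_add)
qed

lemma mult_space_eq: "mult_space q S = (\<lambda>h. q * h) ` S"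
  by (auto simp: mult_space_def times_fun_def)

lemma subspace_mult_space:
  assumes "cfun.subspace S"
  shows "cfun.subspace (mult_space q S)"
proof (rule cfun.subspaceI)
  show "0 \<in> mult_space q S"
    unfolding mult_space_eq using cfun.subspace_0[OF assms] by (intro image_eqI[of _ _ 0]) simp_all
  fix f g c
  assume "f \<in> mult_space q S"
  then obtain a where a: "f = q * a" "a \<in> S" by (auto simp: mult_space_eq)
  then have "(\<lambda>x. c * f x) = q * (\<lambda>x. c * a x)" by (simp add: fun_eq_iff)
  then show "(\<lambda>x. c * f x) \<in> mult_space q S"
    unfolding mult_space_eq using cfun.subspace_scale[OF assms a(2)] by blast
  assume "g \<in> mult_space q S"
  then obtain b where b: "g = q * b" "b \<in> S" by (auto simp: mult_space_eq)
  then have "f + g = q * (a + b)" by (simp only: a distrib_left)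
  then show "f + g \<in> mult_space q S"
    unfolding mult_space_eq using cfun.subspace_add[OF assms a(2) b(2)] by blast
qed

lemma span_UN_finite_sum:
  fixes W :: "'i \<Rightarrow> ('a \<Rightarrow> complex) set"
  assumes W: "\<And>n. n \<in> I \<Longrightarrow> cfun.subspace (W n)"
    and p: "p \<in> cfun.span (\<Union>n\<in>I. W n)"
  shows "\<exists>v. (\<forall>n\<in>I. v n \<in> W n) \<and> (\<forall>n. n \<notin> I \<longrightarrow> v n = 0) \<and>
    finite {n. v n \<noteq> 0} \<and> p = (\<Sum>n | v n \<noteq> 0. v n)"
  using p
proof (induction rule: cfun.span_induct_alt)
  case base
  have "\<forall>n\<in>I. 0 \<in> W n" using W cfun.subspace_0 by blast
  then show ?case
    by (intro exI[of _ "\<lambda>_. 0"]) (simp only: simp_thms Collect_empty_eq sum.empty finite.emptyI empty_def[symmetric])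
next
  case (step c a y)
  then obtain k where k: "k \<in> I" "a \<in> W k" by blast
  from step obtain v where v: "\<And>n. n \<in> I \<Longrightarrow> v n \<in> W n" "\<And>n. n \<notin> I \<Longrightarrow> v n = 0"
    "finite {n. v n \<noteq> 0}" "y = (\<Sum>n | v n \<noteq> 0. v n)" by blast
  \<comment> \<open>The new term is absorbed into component \<open>k\<close>. That component may
    cancel to 0, so the sums are compared over the larger set \<open>?A\<close>.\<close>
  define u where "u = v(k := (\<lambda>x. c * a x) + v k)"
  let ?A = "insert k {n. v n \<noteq> 0}"
  have fin: "finite ?A" using v(3) by simp
  have sub: "{n. u n \<noteq> 0} \<subseteq> ?A" by (auto simp: u_def)
  have "(\<Sum>n | u n \<noteq> 0. u n) = (\<Sum>n\<in>?A. u n)"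
    by (rule sum.mono_neutral_left[OF fin sub]) auto
  also have "\<dots> = u k + (\<Sum>n\<in>?A - {k}. u n)" by (rule sum.remove[OF fin insertI1])
  also have "(\<Sum>n\<in>?A - {k}. u n) = (\<Sum>n\<in>?A - {k}. v n)" by (rule sum.cong) (auto simp: u_def)
  also have "u k + (\<Sum>n\<in>?A - {k}. v n) = (\<lambda>x. c * a x) + (v k + (\<Sum>n\<in>?A - {k}. v n))"
    by (simp only: u_def fun_upd_same add.assoc)
  also have "v k + (\<Sum>n\<in>?A - {k}. v n) = (\<Sum>n\<in>?A. v n)"
    by (rule sum.remove[OF fin insertI1, symmetric])
  also have "(\<Sum>n\<in>?A. v n) = y"
    unfolding v(4) by (rule sum.mono_neutral_right[OF fin]) auto
  finally have "(\<lambda>x. c * a x) + y = (\<Sum>n | u n \<noteq> 0. u n)" by (rule sym)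
  moreover have "u n \<in> W n" if "n \<in> I" for n
    using v(1)[OF that] cfun.subspace_add[OF W[OF k(1)] cfun.subspace_scale[OF W[OF k(1)] k(2)] v(1)[OF k(1)]]
    by (cases "n = k") (simp_all only: u_def fun_upd_same fun_upd_other not_False_eq_True)
  moreover have "u n = 0" if "n \<notin> I" for n
    using v(2)[OF that] k(1) that by (cases "n = k") (auto simp: u_def)
  moreover have "finite {n. u n \<noteq> 0}" using finite_subset[OF sub fin] .
  ultimately show ?case by blast
qed

section \<open>Existence of harmonic expansions\<close>

lemma polys_subset_span_harmonics:
  fixes p :: "real ^ 'm ^ 'k::{finite,linorder} \<Rightarrow> complex"
  assumes "p \<in> polys"
  shows "p \<in> cfun.span (\<Union>n\<in>exponent_families. mult_space (rsq_monomial n) harmonics)" (is "_ \<in> cfun.span ?U")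
proof -
  have rsq_closed: "rsq i j * q \<in> cfun.span ?U" if "i \<le> j" "q \<in> cfun.span ?U" for i j q
    using that(2)
  proof (induction rule: cfun.span_induct_alt)
    case base
    show ?case using cfun.span_zero by (simp only: mult_zero_right)
  next
    case (step c a q)
    then obtain n h where n: "n \<in> exponent_families" "h \<in> harmonics" "a = rsq_monomial n * h"
      by (auto simp: mult_space_eq)
    have ij: "(i, j) \<in> index_pairs" using that(1) by (simp add: index_pairs_def)
    \<comment> \<open>The raised entry lies in \<open>index_pairs\<close>, so the family stays
      extensional.\<close>
    let ?n = "n((i, j) := Suc (n (i, j)))"
    have "(rsq_monomial ?n :: real ^ 'm ^ 'k::{finite,linorder} \<Rightarrow> complex) = rsq i j * rsq_monomial n"
      unfolding rsq_monomial_eq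
      by (subst (1 2) prod.remove[OF finite_index_pairs ij]) (simp add: mult.assoc)
    then have "rsq i j * a = rsq_monomial ?n * h" by (simp only: n mult.assoc)
    moreover have "?n \<in> exponent_families"
      using n(1) ij unfolding exponent_families_def by (intro PiE_I) (auto simp: PiE_iff extensional_def)
    ultimately have "rsq i j * a \<in> cfun.span ?U"
      using n(2) by (intro cfun.span_base) (auto simp only: mult_space_eq)
    moreover have "rsq i j * ((\<lambda>x. c * a x) + q) = (\<lambda>x. c * (rsq i j * a) x) + rsq i j * q"
      by (simp add: fun_eq_iff algebra_simps)
    ultimately show ?case using step.IH by (simp only: cfun.span_add cfun.span_scale)
  qed
  have harmonic: "h \<in> cfun.span ?U" if "h \<in> harmonics" for h
  proof -
    \<comment> \<open>The zero family must be \<open>undefined\<close> off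
      \<open>index_pairs\<close> to belong to \<open>exponent_families\<close>.\<close>
    let ?n = "restrict (\<lambda>_. 0) index_pairs :: 'k \<times> 'k \<Rightarrow> nat"
    have "rsq_monomial ?n = (1 :: real ^ 'm ^ 'k::{finite,linorder} \<Rightarrow> complex)"
      unfolding rsq_monomial_eq by (rule prod.neutral) simp
    then have "h = rsq_monomial ?n * h" by simp
    moreover have "?n \<in> exponent_families" by (simp add: exponent_families_def)
    ultimately show ?thesis using that by (intro cfun.span_base) (auto simp only: mult_space_eq)
  qed
  \<comment> \<open>Strong induction on the degree: the non-harmonic part consists of multiples
    \<open>rsq i j * mon \<alpha>\<close> with \<open>deg \<alpha> < d\<close>, and
    \<open>rsq_closed\<close> carries the expansion of \<open>mon \<alpha>\<close> over to the
    product.\<close>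
  have "cfun.span (mon ` {\<alpha>. deg \<alpha> \<le> d}) \<subseteq> cfun.span ?U" for d
  proof (induction d rule: less_induct)
    case (less d)
    show ?case
    proof
      fix p :: "real ^ 'm ^ 'k::{finite,linorder} \<Rightarrow> complex"
      assume "p \<in> cfun.span (mon ` {\<alpha>. deg \<alpha> \<le> d})"
      then obtain h y where hy: "h \<in> harmonics" "p = h + y"
        and y: "y \<in> cfun.span {rsq i j * mon \<alpha> | i j \<alpha>. i \<le> j \<and> deg \<alpha> + 2 \<le> d}"
        by (rule harmonic_decomposition)
      have "{rsq i j * mon \<alpha> | i j \<alpha>. i \<le> j \<and> deg \<alpha> + 2 \<le> d} \<subseteq> cfun.span ?U"
      proof
        fix s :: "real ^ 'm ^ 'k::{finite,linorder} \<Rightarrow> complex"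
        assume "s \<in> {rsq i j * mon \<alpha> | i j \<alpha>. i \<le> j \<and> deg \<alpha> + 2 \<le> d}"
        then obtain i j \<alpha> where s: "s = rsq i j * mon \<alpha>" "i \<le> j" "deg \<alpha> + 2 \<le> d" by blast
        have "mon \<alpha> \<in> cfun.span ?U"
          using less.IH[of "deg \<alpha>"] s(3) cfun.span_base[OF imageI[of \<alpha> "{\<beta>. deg \<beta> \<le> deg \<alpha>}" mon]] by auto
        then show "s \<in> cfun.span ?U" unfolding s(1) by (rule rsq_closed[OF s(2)])
      qed
      then have "y \<in> cfun.span ?U" using y cfun.span_minimal[OF _ cfun.subspace_span] by blast
      with harmonic[OF hy(1)] show "p \<in> cfun.span ?U" unfolding hy(2) by (rule cfun.span_add)
    qed
  qed
  then show ?thesis using polys_deg[OF assms] by blast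
qed

section \<open>Existence and uniqueness combined\<close>

theorem theoremA:
  assumes "CARD('m) \<ge> 2 * CARD('k::{finite,linorder}) - 1"
  shows "cfun.internal_direct_sum (polys :: (real ^ 'm ^ 'k::{finite,linorder} \<Rightarrow> complex) set)
           exponent_families (\<lambda>n. mult_space (rsq_monomial n) harmonics)"
proof -
  let ?W = "\<lambda>n. mult_space (rsq_monomial n) harmonics :: (real ^ 'm ^ 'k::{finite,linorder} \<Rightarrow> complex) set"
  let ?Q = "\<lambda>p v. (\<forall>n\<in>exponent_families. v n \<in> ?W n) \<and> (\<forall>n. n \<notin> exponent_families \<longrightarrow> v n = 0) \<and>
    finite {n. v n \<noteq> 0} \<and> p = (\<Sum>n | v n \<noteq> 0. v n)"
  obtain w and \<mu> :: "'k \<times> 'k \<Rightarrow> 'k \<times> 'm \<Rightarrow> nat" where "coprime_leading_exponents w \<mu>"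
    using ex_coprime_leading_exponents[OF assms] by blast
  then interpret coprime_leading_exponents w \<mu> .
  have sub: "cfun.subspace (?W n)" for n by (rule subspace_mult_space[OF subspace_harmonics])
  have W_polys: "?W n \<subseteq> polys" for n
    unfolding mult_space_eq using harmonics_subset polys_mult[OF rsq_monomial_in_polys] by blast
  have unique: "v = v'" if v: "?Q p v" and v': "?Q p v'" for p v v'
  proof
    fix n
    \<comment> \<open>The difference of two expansions becomes a relation among terms
      \<open>rsq_monomial n * h n\<close> over the finite union of both supports, to which
      \<open>harmonic_expansion_unique\<close> applies.\<close>
    define u where "u = (\<lambda>n. v n - v' n)"
    let ?F = "{n. v n \<noteq> 0} \<union> {n. v' n \<noteq> 0}"
    have F: "finite ?F" "?F \<subseteq> exponent_families" using v v' by blast+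
    have "\<exists>h. h \<in> harmonics \<and> u n = rsq_monomial n * h" if "n \<in> ?F" for n
    proof -
      have "n \<in> exponent_families" using F that by blast
      then have "u n \<in> ?W n" unfolding u_def using v v' by (intro cfun.subspace_diff[OF sub]) blast+
      then show ?thesis by (auto simp only: mult_space_eq)
    qed
    then obtain h where h: "\<And>n. n \<in> ?F \<Longrightarrow> h n \<in> harmonics" "\<And>n. n \<in> ?F \<Longrightarrow> u n = rsq_monomial n * h n"
      by metis
    have "(\<Sum>n\<in>?F. rsq_monomial n * h n) = (\<Sum>n\<in>?F. u n)" by (rule sum.cong) (simp_all only: h)
    also have "\<dots> = (\<Sum>n\<in>?F. v n) - (\<Sum>n\<in>?F. v' n)" by (simp only: u_def sum_subtractf)
    also have "(\<Sum>n\<in>?F. v n) = (\<Sum>n | v n \<noteq> 0. v n)"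
      by (rule sum.mono_neutral_right[OF F(1)]) auto
    also have "(\<Sum>n\<in>?F. v' n) = (\<Sum>n | v' n \<noteq> 0. v' n)"
      by (rule sum.mono_neutral_right[OF F(1)]) auto
    also have "(\<Sum>n | v n \<noteq> 0. v n) - (\<Sum>n | v' n \<noteq> 0. v' n) = p - p" using v v' by argo
    finally have "(\<Sum>n\<in>?F. rsq_monomial n * h n) = 0" by (simp only: diff_self)
    then have "\<forall>n\<in>?F. h n = 0"
      by (rule harmonic_expansion_unique[OF F, rotated]) (rule h(1))
    then have "u n = 0" if "n \<in> ?F" using h(2)[OF that] that by simp
    then show "v n = v' n" by (cases "n \<in> ?F") (auto simp: u_def)
  qed
  have "\<exists>!v. ?Q p v" if "p \<in> polys" for p
  proof -
    have "\<exists>v. ?Q p v" using polys_subset_span_harmonics[OF that] by (rule span_UN_finite_sum[OF sub])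
    then show ?thesis using unique by blast
  qed
  then show ?thesis
    unfolding cfun.internal_direct_sum_def by (intro conjI ballI subspace_polys sub W_polys)
qed

end
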